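(* Let $q$ be a prime and let $n,r,k$ be positive integers such that $k$ divides $r$ and $\frac rk$ divides $n$. Let $C_n=\langle\sigma\rangle$ be a cyclic group of order $n$ acting on $\mathbb{F}_{q^r}$ via $\eta:C_n\to\mathrm{Aut}(\mathbb{F}_{q^r})$, $\eta(\sigma)=\varphi^k$, where $\varphi:x\mapsto x^q$ is the Frobenius automorphism. Let $f\in Z^2_\eta(C_n,\mathbb{F}_{q^r}^* )$. Then the crossed product $(\mathbb{F}_{q^r})_\eta^f*C_n$ is a semisimple ring if and only if $\gcd(\frac{nk}{r},q)=1$.
   Context: For a finite group $G$ acting on a commutative ring $R$ via $\eta:G\to\mathrm{Aut}(R)$ (write $g(r)=\eta(g)(r)$), $Z^2_\eta(G,R^* )$ denotes the 2-cocycles $f:G\times G\to R^*$, i.e. $f(g,h)f(gh,k)=g(f(h,k))f(g,hk)$. The crossed product $R_\eta^f*G$ is the associative ring which is a free left $R$-module with basis $\{u_g\}_{g\in G}$ and multiplication determined by $(\beta u_g)(\gamma u_h)=\beta\,g(\gamma)\,f(g,h)\,u_{gh}$ for $\beta,\gamma\in R$. *)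

theory Defs
  imports "HOL-Algebra.Algebra" "HOL-Computational_Algebra.Primes"
begin

(* The analogue for rings of the library's AutoGroup; as there, an automorphism is an extensional
   function and multiplication is composition, (g h)(r) = g (h r). *)
definition RingAutoGroup :: "('a, 'b) ring_scheme \<Rightarrow> ('a \<Rightarrow> 'a) monoid"
  where "RingAutoGroup R =
    BijGroup (carrier R) \<lparr>carrier := ring_iso R R \<inter> Bij (carrier R)\<rparr>"

definition frobenius :: "('a, 'b) ring_scheme \<Rightarrow> nat \<Rightarrow> 'a \<Rightarrow> 'a"
  where "frobenius R q = (\<lambda>x \<in> carrier R. x [^]\<^bsub>R\<^esub> q)"

(* Cocycles are not assumed to be normalised, and their values outside
   carrier G are irrelevant. *)
definition two_cocycles ::
    "('g, 'c) monoid_scheme \<Rightarrow> ('a, 'b) ring_scheme \<Rightarrow> ('g \<Rightarrow> 'a \<Rightarrow> 'a) \<Rightarrow> ('g \<Rightarrow> 'g \<Rightarrow> 'a) set"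
  where "two_cocycles G R \<eta> =
    {f. (\<forall>g \<in> carrier G. \<forall>h \<in> carrier G. f g h \<in> Units R) \<and>
        (\<forall>g \<in> carrier G. \<forall>h \<in> carrier G. \<forall>k \<in> carrier G.
           f g h \<otimes>\<^bsub>R\<^esub> f (g \<otimes>\<^bsub>G\<^esub> h) k = \<eta> g (f h k) \<otimes>\<^bsub>R\<^esub> f g (h \<otimes>\<^bsub>G\<^esub> k))}"

(* For finite G: the function a stands for the sum of the a(g) u_g. The multiplication is the
   biadditive extension of (\<beta> u_g) (\<gamma> u_h) = \<beta> g(\<gamma>) f(g,h) u_{gh}. As f need not be normalised,
   the identity element is f(1,1)^{-1} u_1. *)
definition crossed_product ::
    "('a, 'b) ring_scheme \<Rightarrow> ('g, 'c) monoid_scheme \<Rightarrow> ('g \<Rightarrow> 'a \<Rightarrow> 'a) \<Rightarrow> ('g \<Rightarrow> 'g \<Rightarrow> 'a)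
       \<Rightarrow> ('g \<Rightarrow> 'a) ring"
  where "crossed_product R G \<eta> f =
    \<lparr>carrier = carrier G \<rightarrow>\<^sub>E carrier R,
     monoid.mult = (\<lambda>a b. \<lambda>x \<in> carrier G.
       finsum R (\<lambda>(g, h). a g \<otimes>\<^bsub>R\<^esub> \<eta> g (b h) \<otimes>\<^bsub>R\<^esub> f g h)
         {(g, h) \<in> carrier G \<times> carrier G. g \<otimes>\<^bsub>G\<^esub> h = x}),
     monoid.one = (\<lambda>x \<in> carrier G. if x = \<one>\<^bsub>G\<^esub> then inv\<^bsub>R\<^esub> (f \<one>\<^bsub>G\<^esub> \<one>\<^bsub>G\<^esub>) else \<zero>\<^bsub>R\<^esub>),
     ring.zero = (\<lambda>x \<in> carrier G. \<zero>\<^bsub>R\<^esub>),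
     ring.add = (\<lambda>a b. \<lambda>x \<in> carrier G. a x \<oplus>\<^bsub>R\<^esub> b x)\<rparr>"

locale left_ideal = additive_subgroup I R + ring R for I and R (structure) +
  assumes I_l_closed: "\<lbrakk>a \<in> I; x \<in> carrier R\<rbrakk> \<Longrightarrow> x \<otimes> a \<in> I"

(* The submodules of the left regular module are the left ideals. *)
definition simple_left_ideal :: "'a set \<Rightarrow> ('a, 'b) ring_scheme \<Rightarrow> bool"
  where "simple_left_ideal I R \<longleftrightarrow>
    left_ideal I R \<and> I \<noteq> {\<zero>\<^bsub>R\<^esub>} \<and>
    (\<forall>J. left_ideal J R \<and> J \<subseteq> I \<longrightarrow> J = {\<zero>\<^bsub>R\<^esub>} \<or> J = I)"

definition left_ideal_sum :: "('a, 'b) ring_scheme \<Rightarrow> 'a set set \<Rightarrow> 'a set"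
  where "left_ideal_sum R S = \<Inter>{J. left_ideal J R \<and> \<Union>S \<subseteq> J}"

(* The left regular module is the internal direct sum of a family of simple submodules. *)
definition semisimple_ring :: "('a, 'b) ring_scheme \<Rightarrow> bool"
  where "semisimple_ring R \<longleftrightarrow> ring R \<and>
    (\<exists>S. (\<forall>I \<in> S. simple_left_ideal I R) \<and>
         (\<forall>I \<in> S. I \<inter> left_ideal_sum R (S - {I}) = {\<zero>\<^bsub>R\<^esub>}) \<and>
         left_ideal_sum R S = carrier R)"

end

theory Submission
  imports Defs
begin

text \<open>
  If \<open>gcd (nk/r, q) = 1\<close>, the trace \<open>x \<mapsto> \<Sum>\<^sub>g g(x)\<close> is \<open>nk/r\<close> times a nonzero polynomial function of degree
  less than \<open>q\<^sup>r\<close>, hence does not vanish identically. An element of trace one allows one to average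
  linear projections over the group, so every left ideal has a complement.

  If \<open>q\<close> divides \<open>nk/r\<close>, then \<open>\<rho> = \<sigma>\<^bsup>n/q\<^esup>\<close> has order \<open>q\<close> and acts trivially. Since \<open>x \<mapsto> x\<^sup>q\<close> is
  bijective on the field, \<open>u\<^sub>\<rho>\<close> can be rescaled to a central \<open>v\<close> with \<open>v\<^sup>q = 1\<close>, and \<open>\<Sum>\<^bsub>i<q\<^esub> v\<^sup>i\<close> is a
  nonzero central element of square zero, which annihilates every simple left ideal.
\<close>

section \<open>Left ideals\<close>

text \<open>Since \<open>q\<close> may divide \<open>n\<close> while being prime to
  \<open>nk/r\<close>, dividing by the group order as in Maschke's theorem is not an option. The
  relevant number \<open>m = nk/r\<close> is the order of the kernel of the action:
  \<open>\<sigma>^i\<close> acts as x \<mapsto> x^(q^(ki)), hence trivially exactly when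
  \<open>r/k\<close> divides \<open>i\<close>. The polynomial behind the trace is the sum of
  X^(q^(ki)) over i < r/k, with distinct exponents below q^r; counting its roots stands in for the
  independence of automorphisms. As the field need not be central in the crossed product, the weight
  of trace one has to stand between \<open>u_g\<close> and the projection, where the group
  conjugates it. In the converse, the delicate point is that \<open>v\<close> is central. A basis
  element commutes with \<open>v\<close> only up to a scalar \<open>l\<close>; v^q = 1 gives l^q =
  1, and injectivity of x \<mapsto> x^q forces l = 1. Surjectivity of the same map supplies the
  scaling factor. The cocycle is arbitrary, so the factor \<open>f(1,1)\<close> accompanies all
  computations.\<close>

context ring
begin

lemma left_ideal_intro:
  assumes "I \<subseteq> carrier R" "\<zero> \<in> I"
    and "\<And>x y. \<lbrakk>x \<in> I; y \<in> I\<rbrakk> \<Longrightarrow> x \<oplus> y \<in> I"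
    and "\<And>a x. \<lbrakk>a \<in> carrier R; x \<in> I\<rbrakk> \<Longrightarrow> a \<otimes> x \<in> I"
  shows "left_ideal I R"
proof -
  have "\<ominus> x \<in> I" if "x \<in> I" for x
  proof -
    have "(\<ominus> \<one>) \<otimes> x \<in> I"
      using assms(4)[OF _ that] by simp
    then show ?thesis
      using assms(1) that by (auto simp: l_minus)
  qed
  then have "subgroup I (add_monoid R)"
    by (intro subgroup.intro) (use assms(1-3) in \<open>auto simp flip: a_inv_def\<close>)
  then show ?thesis
    using assms(4)
    by (intro left_ideal.intro left_ideal_axioms.intro additive_subgroup.intro ring_axioms)
qed

lemma left_idealD:
  assumes "left_ideal I R"
  shows "I \<subseteq> carrier R" "\<zero> \<in> I"
    and "\<And>x y. \<lbrakk>x \<in> I; y \<in> I\<rbrakk> \<Longrightarrow> x \<oplus> y \<in> I"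
    and "\<And>a x. \<lbrakk>a \<in> carrier R; x \<in> I\<rbrakk> \<Longrightarrow> a \<otimes> x \<in> I"
    and "\<And>x. x \<in> I \<Longrightarrow> \<ominus> x \<in> I"
    and "\<And>x y. \<lbrakk>x \<in> I; y \<in> I\<rbrakk> \<Longrightarrow> x \<ominus> y \<in> I"
proof -
  interpret left_ideal I R by fact
  show "I \<subseteq> carrier R" "\<zero> \<in> I"
    and "\<And>x y. \<lbrakk>x \<in> I; y \<in> I\<rbrakk> \<Longrightarrow> x \<oplus> y \<in> I"
    and "\<And>a x. \<lbrakk>a \<in> carrier R; x \<in> I\<rbrakk> \<Longrightarrow> a \<otimes> x \<in> I"
    and "\<And>x. x \<in> I \<Longrightarrow> \<ominus> x \<in> I"
    and "\<And>x y. \<lbrakk>x \<in> I; y \<in> I\<rbrakk> \<Longrightarrow> x \<ominus> y \<in> I"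
    using a_subset I_l_closed by (auto simp: minus_eq)
qed

lemma left_ideal_carrier: "left_ideal (carrier R) R"
  by (rule left_ideal_intro) auto

lemma left_ideal_zero: "left_ideal {\<zero>} R"
  by (rule left_ideal_intro) auto

lemma left_ideal_Int:
  assumes "left_ideal I R" "left_ideal J R"
  shows "left_ideal (I \<inter> J) R"
  by (rule left_ideal_intro) (use left_idealD[OF assms(1)] left_idealD[OF assms(2)] in auto)

lemma left_ideal_add:
  assumes "left_ideal I R" "left_ideal J R"
  shows "left_ideal (I <+>\<^bsub>R\<^esub> J) R"
proof (rule left_ideal_intro)
  note I = left_idealD[OF assms(1)] and J = left_idealD[OF assms(2)]
  show "I <+>\<^bsub>R\<^esub> J \<subseteq> carrier R"
    using I(1) J(1) by (auto simp: set_add_def')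
  show "\<zero> \<in> I <+>\<^bsub>R\<^esub> J"
    using I(2) J(2) unfolding set_add_def' by force
  show "x \<oplus> y \<in> I <+>\<^bsub>R\<^esub> J" if xy: "x \<in> I <+>\<^bsub>R\<^esub> J" "y \<in> I <+>\<^bsub>R\<^esub> J" for x y
  proof -
    obtain a b c d where *: "a \<in> I" "b \<in> J" "x = a \<oplus> b" "c \<in> I" "d \<in> J" "y = c \<oplus> d"
      using xy unfolding set_add_def' by auto
    then have "{a, b, c, d} \<subseteq> carrier R"
      using I(1) J(1) by auto
    then have "x \<oplus> y = (a \<oplus> c) \<oplus> (b \<oplus> d)"
      using * by (simp add: a_ac)
    then show ?thesis
      using I(3)[of a c] J(3)[of b d] * unfolding set_add_def' by blast
  qed
  show "a \<otimes> x \<in> I <+>\<^bsub>R\<^esub> J" if ax: "a \<in> carrier R" "x \<in> I <+>\<^bsub>R\<^esub> J" for a x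
  proof -
    obtain b c where *: "b \<in> I" "c \<in> J" "x = b \<oplus> c"
      using ax(2) unfolding set_add_def' by auto
    then have "b \<in> carrier R" "c \<in> carrier R"
      using I(1) J(1) by auto
    then have "a \<otimes> x = a \<otimes> b \<oplus> a \<otimes> c"
      using * ax(1) by (simp add: r_distr)
    then show ?thesis
      using I(4)[OF ax(1), of b] J(4)[OF ax(1), of c] * unfolding set_add_def' by blast
  qed
qed

lemma left_ideal_add_upper:
  assumes "left_ideal I R" "left_ideal J R"
  shows "I \<subseteq> I <+>\<^bsub>R\<^esub> J" "J \<subseteq> I <+>\<^bsub>R\<^esub> J"
proof -
  note I = left_idealD[OF assms(1)] and J = left_idealD[OF assms(2)]
  show "I \<subseteq> I <+>\<^bsub>R\<^esub> J"
  proof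
    fix x assume "x \<in> I"
    then have "x = x \<oplus> \<zero>" using I(1) by auto
    with \<open>x \<in> I\<close> J(2) show "x \<in> I <+>\<^bsub>R\<^esub> J" unfolding set_add_def' by blast
  qed
  show "J \<subseteq> I <+>\<^bsub>R\<^esub> J"
  proof
    fix x assume "x \<in> J"
    then have "x = \<zero> \<oplus> x" using J(1) by auto
    with \<open>x \<in> J\<close> I(2) show "x \<in> I <+>\<^bsub>R\<^esub> J" unfolding set_add_def' by blast
  qed
qed

lemma left_ideal_add_least:
  assumes "left_ideal K R" "I \<subseteq> K" "J \<subseteq> K"
  shows "I <+>\<^bsub>R\<^esub> J \<subseteq> K"
  using left_idealD(3)[OF assms(1)] assms(2,3) unfolding set_add_def' by blast

section \<open>Sums of families of left ideals\<close>

lemma left_ideal_sum_least: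
  assumes "left_ideal J R" "\<And>I. I \<in> S \<Longrightarrow> I \<subseteq> J"
  shows "left_ideal_sum R S \<subseteq> J"
  using assms unfolding left_ideal_sum_def by auto

lemma left_ideal_sum_upper: "I \<in> S \<Longrightarrow> I \<subseteq> left_ideal_sum R S"
  unfolding left_ideal_sum_def by auto

lemma left_ideal_left_ideal_sum:
  assumes "\<And>I. I \<in> S \<Longrightarrow> I \<subseteq> carrier R"
  shows "left_ideal (left_ideal_sum R S) R"
proof (rule left_ideal_intro)
  show "left_ideal_sum R S \<subseteq> carrier R"
    by (rule left_ideal_sum_least[OF left_ideal_carrier assms])
qed (auto simp: left_ideal_sum_def dest: left_idealD)

lemma left_ideal_sum_empty: "left_ideal_sum R {} = {\<zero>}"
  using left_ideal_sum_least[OF left_ideal_zero, of "{}"]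
    left_idealD(2)[OF left_ideal_left_ideal_sum[of "{}"]] by auto

text \<open>The sum of a family is defined as an intersection; this recursion is what allows its
  elements to be written as \<open>a \<oplus> b\<close> when independence is checked.\<close>

lemma left_ideal_sum_insert:
  assumes "left_ideal M R" "\<And>I. I \<in> S \<Longrightarrow> left_ideal I R"
  shows "left_ideal_sum R (insert M S) = M <+>\<^bsub>R\<^esub> left_ideal_sum R S"
proof
  have S: "left_ideal (left_ideal_sum R S) R"
    using assms(2) by (intro left_ideal_left_ideal_sum left_idealD(1))
  have MS: "left_ideal (left_ideal_sum R (insert M S)) R"
    using assms by (intro left_ideal_left_ideal_sum left_idealD(1)) auto
  show "left_ideal_sum R (insert M S) \<subseteq> M <+>\<^bsub>R\<^esub> left_ideal_sum R S"
    using left_ideal_add_upper[OF assms(1) S] left_ideal_sum_upper[of _ S]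
    by (intro left_ideal_sum_least left_ideal_add assms S) auto
  show "M <+>\<^bsub>R\<^esub> left_ideal_sum R S \<subseteq> left_ideal_sum R (insert M S)"
    using left_ideal_sum_upper[of _ "insert M S"]
    by (intro left_ideal_add_least left_ideal_sum_least MS) auto
qed

text \<open>A nonzero left ideal of least cardinality inside \<open>I\<close> is simple: in a finite
  set, a subset of the same cardinality is the whole set.\<close>

lemma simple_left_ideal_exists:
  assumes "finite (carrier R)" "left_ideal I R" "I \<noteq> {\<zero>}"
  obtains M where "simple_left_ideal M R" "M \<subseteq> I"
proof -
  define P where "P = (\<lambda>J. left_ideal J R \<and> J \<subseteq> I \<and> J \<noteq> {\<zero>})"
  have "P I" using assms by (simp add: P_def)
  then obtain M where M: "P M" "\<And>J. P J \<Longrightarrow> card M \<le> card J"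
    using ex_has_least_nat[of P I card] by blast
  have "J = M" if "left_ideal J R" "J \<subseteq> M" "J \<noteq> {\<zero>}" for J
  proof -
    have "P J" using that M(1) by (auto simp: P_def)
    moreover have "finite M"
      using M(1) left_idealD(1)[of M] assms(1) by (auto simp: P_def intro: finite_subset)
    ultimately show ?thesis
      using M(2)[of J] that(2) by (metis card_seteq)
  qed
  then have "simple_left_ideal M R"
    using M(1) by (auto simp: simple_left_ideal_def P_def)
  with M(1) that show ?thesis by (auto simp: P_def)
qed

text \<open>Every left ideal \<open>L\<close> is decomposed, by induction on its cardinality. A
  simple \<open>M\<close> inside \<open>L\<close> with complement \<open>N\<close> splits off,
  leaving \<open>L \<inter> N\<close>, which is smaller because it misses the nonzero elements of
  \<open>M\<close>.\<close>

lemma complemented_imp_semisimple: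
  assumes fin: "finite (carrier R)"
    and compl: "\<And>I. left_ideal I R \<Longrightarrow>
      \<exists>J. left_ideal J R \<and> I \<inter> J = {\<zero>} \<and> I <+>\<^bsub>R\<^esub> J = carrier R"
  shows "semisimple_ring R"
proof -
  have "\<exists>S. (\<forall>I \<in> S. simple_left_ideal I R) \<and>
          (\<forall>I \<in> S. I \<inter> left_ideal_sum R (S - {I}) = {\<zero>}) \<and> left_ideal_sum R S = L"
    if "left_ideal L R" for L
    using that
  proof (induction "card L" arbitrary: L rule: less_induct)
    case less
    show ?case
    proof (cases "L = {\<zero>}")
      case True
      then show ?thesis
        by (intro exI[of _ "{}"]) (simp add: left_ideal_sum_empty)
    next
      case False
      then obtain M where M: "simple_left_ideal M R" "M \<subseteq> L"
        using simple_left_ideal_exists[OF fin less.prems] by blast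
      then have lM: "left_ideal M R" and M0: "M \<noteq> {\<zero>}"
        by (auto simp: simple_left_ideal_def)
      obtain N where N: "left_ideal N R" "M \<inter> N = {\<zero>}" "M <+>\<^bsub>R\<^esub> N = carrier R"
        using compl[OF lM] by blast
      note Md = left_idealD[OF lM] and Nd = left_idealD[OF N(1)] and Ld = left_idealD[OF less.prems]
      have lLN: "left_ideal (L \<inter> N) R"
        by (rule left_ideal_Int[OF less.prems N(1)])
      obtain x where x: "x \<in> M" "x \<noteq> \<zero>" using M0 Md(2) by blast
      then have "x \<in> L - (L \<inter> N)" using N(2) M(2) by auto
      moreover have "finite L" using Ld(1) fin by (rule finite_subset)
      ultimately have "card (L \<inter> N) < card L"
        by (intro psubset_card_mono) auto
      from less.hyps[OF this lLN] obtain S where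
        S: "\<forall>I \<in> S. simple_left_ideal I R" "\<forall>I \<in> S. I \<inter> left_ideal_sum R (S - {I}) = {\<zero>}"
          "left_ideal_sum R S = L \<inter> N" by blast
      have lS: "left_ideal I R" if "I \<in> S" for I
        using S(1) that by (auto simp: simple_left_ideal_def)
      have SN: "I \<subseteq> N" if "I \<in> S" for I
        using left_ideal_sum_upper[OF that] S(3) by auto
      have "M \<notin> S" using SN[of M] x N(2) by auto
      \<comment> \<open>The modular law: the \<open>N\<close>-component of an element of
        \<open>L\<close> lies in \<open>L\<close>, because its \<open>M\<close>-component
        does.\<close>
      have "M <+>\<^bsub>R\<^esub> (L \<inter> N) = L"
      proof
        show "M <+>\<^bsub>R\<^esub> (L \<inter> N) \<subseteq> L"
          using M(2) by (intro left_ideal_add_least less.prems) auto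
        show "L \<subseteq> M <+>\<^bsub>R\<^esub> (L \<inter> N)"
        proof
          fix y assume y: "y \<in> L"
          then have "y \<in> M <+>\<^bsub>R\<^esub> N" using Ld(1) N(3) by auto
          then obtain a b where ab: "a \<in> M" "b \<in> N" "y = a \<oplus> b"
            unfolding set_add_def' by auto
          then have c: "a \<in> carrier R" "b \<in> carrier R" using Md(1) Nd(1) by auto
          have "b = y \<ominus> a" using ab(3) c a_comm[of a b] by (simp add: minus_eq a_assoc r_neg)
          then have "b \<in> L" using Ld(6) y ab(1) M(2) by auto
          then show "y \<in> M <+>\<^bsub>R\<^esub> (L \<inter> N)" using ab unfolding set_add_def' by blast
        qed
      qed
      then have sum: "left_ideal_sum R (insert M S) = L"
        using left_ideal_sum_insert[OF lM lS] S(3) by simp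
      have indep: "I \<inter> left_ideal_sum R (insert M S - {I}) = {\<zero>}" if I: "I \<in> insert M S" for I
      proof (cases "I = M")
        case True
        then have "insert M S - {I} = S" using \<open>M \<notin> S\<close> by auto
        then show ?thesis using True S(3) N(2) M(2) Ld(2) by auto
      next
        case False
        then have IS: "I \<in> S" using I by simp
        let ?T = "left_ideal_sum R (S - {I})"
        have lT: "left_ideal ?T R"
          using lS by (intro left_ideal_left_ideal_sum left_idealD(1)) auto
        have "?T \<subseteq> N" using SN by (intro left_ideal_sum_least N(1)) auto
        have eq: "left_ideal_sum R (insert M S - {I}) = M <+>\<^bsub>R\<^esub> ?T"
          using left_ideal_sum_insert[OF lM, of "S - {I}"] lS False
          by (metis Diff_iff insert_Diff_if singletonD)
        \<comment> \<open>Both \<open>y\<close> and its component in \<open>?T\<close> lie in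
          \<open>N\<close>, so the component in \<open>M\<close> lies in \<open>M \<inter> N\<close>
          and vanishes. The independence of \<open>S\<close> then applies.\<close>
        have "y = \<zero>" if y: "y \<in> I" "y \<in> M <+>\<^bsub>R\<^esub> ?T" for y
        proof -
          obtain a b where ab: "a \<in> M" "b \<in> ?T" "y = a \<oplus> b"
            using y(2) unfolding set_add_def' by auto
          have c: "a \<in> carrier R" "b \<in> carrier R" using ab Md(1) left_idealD(1)[OF lT] by auto
          have "a = y \<ominus> b" using ab(3) c by (simp add: minus_eq a_assoc r_neg)
          then have "a \<in> N" using Nd(6) y(1) SN[OF IS] ab(2) \<open>?T \<subseteq> N\<close> by auto
          then have "a = \<zero>" using ab(1) N(2) by auto
          then have "y \<in> ?T" using ab c by simp
          then show ?thesis using y(1) S(2) IS by auto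
        qed
        moreover have "\<zero> \<in> I" "\<zero> \<in> M <+>\<^bsub>R\<^esub> ?T"
          using left_idealD(2)[OF lS[OF IS]] left_idealD(2)[OF left_ideal_add[OF lM lT]] by auto
        ultimately show ?thesis unfolding eq by blast
      qed
      show ?thesis
        using S(1) M(1) sum indep by (intro exI[of _ "insert M S"]) auto
    qed
  qed
  from this[OF left_ideal_carrier] show ?thesis
    unfolding semisimple_ring_def using ring_axioms by blast
qed

text \<open>The annihilator \<open>Z\<close> of \<open>z\<close> is a left ideal since
  \<open>z\<close> is central. If a simple \<open>I\<close> met \<open>Z\<close> only in zero, then
  \<open>z \<otimes> I\<close>, which lies in \<open>I \<inter> Z\<close> because \<open>z\<close>
  squares to zero, would vanish, so \<open>I \<subseteq> Z\<close> in every case. Hence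
  \<open>Z\<close> contains \<open>\<one>\<close>.\<close>

lemma semisimple_central_square_zero:
  assumes "semisimple_ring R" "z \<in> carrier R" "z \<otimes> z = \<zero>"
    and central: "\<And>a. a \<in> carrier R \<Longrightarrow> z \<otimes> a = a \<otimes> z"
  shows "z = \<zero>"
proof -
  define Z where "Z = {x \<in> carrier R. z \<otimes> x = \<zero>}"
  have Z: "left_ideal Z R"
  proof (rule left_ideal_intro)
    show "a \<otimes> x \<in> Z" if "a \<in> carrier R" "x \<in> Z" for a x
      using that assms(2) central[of a] m_assoc[of z a x] m_assoc[of a z x] by (auto simp: Z_def)
  qed (use assms(2) in \<open>auto simp: Z_def r_distr\<close>)
  obtain S where S: "\<forall>I \<in> S. simple_left_ideal I R" "left_ideal_sum R S = carrier R"
    using assms(1) unfolding semisimple_ring_def by blast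
  have "I \<subseteq> Z" if "I \<in> S" for I
  proof -
    have I: "left_ideal I R" "\<And>J. \<lbrakk>left_ideal J R; J \<subseteq> I\<rbrakk> \<Longrightarrow> J = {\<zero>} \<or> J = I"
      using S(1) that unfolding simple_left_ideal_def by auto
    note Id = left_idealD[OF I(1)]
    consider "I \<inter> Z = {\<zero>}" | "I \<inter> Z = I"
      using I(2)[OF left_ideal_Int[OF I(1) Z]] by blast
    then show ?thesis
    proof cases
      case 1
      have "z \<otimes> x = \<zero>" if "x \<in> I" for x
      proof -
        have "z \<otimes> (z \<otimes> x) = \<zero>"
          using that Id(1) assms(2,3) m_assoc[of z z x] by auto
        then have "z \<otimes> x \<in> I \<inter> Z"
          using that Id(1,4) assms(2) by (auto simp: Z_def)
        then show ?thesis using 1 by blast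
      qed
      then show ?thesis using Id(1) by (auto simp: Z_def)
    qed auto
  qed
  then have "carrier R \<subseteq> Z"
    using left_ideal_sum_least[OF Z] S(2) by metis
  then have "\<one> \<in> Z" by auto
  then show ?thesis using assms(2) by (simp add: Z_def)
qed

end

section \<open>The ring axioms for crossed products\<close>

text \<open>Stated for bijections, since this is all that the product of \<open>BijGroup\<close>
  tests; powers of Frobenius can thus be composed knowing only that they are bijective.\<close>

lemma RingAutoGroup_mult:
  assumes "g \<in> Bij (carrier R)" "h \<in> Bij (carrier R)"
  shows "g \<otimes>\<^bsub>RingAutoGroup R\<^esub> h = compose (carrier R) g h"
  using assms by (auto simp: RingAutoGroup_def BijGroup_def)

locale crossed_product_datum = cring R + G: group G for R (structure) and G +
  fixes \<eta> f
  assumes finite_G: "finite (carrier G)"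
    and action: "\<eta> \<in> hom G (RingAutoGroup R)"
    and cocycle: "f \<in> two_cocycles G R \<eta>"
begin

abbreviation A where "A \<equiv> crossed_product R G \<eta> f"

section \<open>The action and the cocycle, in particular at the identity\<close>

lemma action_automorphism:
  assumes "g \<in> carrier G"
  shows "\<eta> g \<in> ring_hom R R" "bij_betw (\<eta> g) (carrier R) (carrier R)"
proof -
  have "\<eta> g \<in> carrier (RingAutoGroup R)"
    using action assms by (auto simp: hom_def)
  then show "\<eta> g \<in> ring_hom R R" "bij_betw (\<eta> g) (carrier R) (carrier R)"
    by (auto simp: RingAutoGroup_def ring_iso_def)
qed

lemma action_simps [simp]:
  assumes "g \<in> carrier G"
  shows "x \<in> carrier R \<Longrightarrow> \<eta> g x \<in> carrier R"
    and "\<eta> g \<one> = \<one>" "\<eta> g \<zero> = \<zero>"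
    and "\<lbrakk>x \<in> carrier R; y \<in> carrier R\<rbrakk> \<Longrightarrow> \<eta> g (x \<otimes> y) = \<eta> g x \<otimes> \<eta> g y"
    and "\<lbrakk>x \<in> carrier R; y \<in> carrier R\<rbrakk> \<Longrightarrow> \<eta> g (x \<oplus> y) = \<eta> g x \<oplus> \<eta> g y"
    and "x \<in> Units R \<Longrightarrow> \<eta> g x \<in> Units R"
proof -
  interpret h: ring_hom_cring R R "\<eta> g"
    by unfold_locales (rule action_automorphism[OF assms])
  show "x \<in> carrier R \<Longrightarrow> \<eta> g x \<in> carrier R"
    and "\<eta> g \<one> = \<one>" "\<eta> g \<zero> = \<zero>"
    and "\<lbrakk>x \<in> carrier R; y \<in> carrier R\<rbrakk> \<Longrightarrow> \<eta> g (x \<otimes> y) = \<eta> g x \<otimes> \<eta> g y"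
    and "\<lbrakk>x \<in> carrier R; y \<in> carrier R\<rbrakk> \<Longrightarrow> \<eta> g (x \<oplus> y) = \<eta> g x \<oplus> \<eta> g y"
    by simp_all
  show "\<eta> g x \<in> Units R" if "x \<in> Units R"
  proof -
    have "\<eta> g (inv x \<otimes> x) = \<one>" "\<eta> g (x \<otimes> inv x) = \<one>"
      using that by (simp_all del: h.hom_mult)
    then have "\<eta> g (inv x) \<otimes> \<eta> g x = \<one>" "\<eta> g x \<otimes> \<eta> g (inv x) = \<one>"
      using that by (simp_all add: Units_closed del: Units_l_inv Units_r_inv)
    then show ?thesis
      using that Units_inv_closed[OF that] Units_closed[OF that]
      unfolding Units_def[of R] by (auto intro!: bexI[of _ "\<eta> g (inv x)"])
  qed
qed

lemma action_mult:
  assumes "g \<in> carrier G" "h \<in> carrier G" "x \<in> carrier R"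
  shows "\<eta> (g \<otimes>\<^bsub>G\<^esub> h) x = \<eta> g (\<eta> h x)"
proof -
  have "\<eta> (g \<otimes>\<^bsub>G\<^esub> h) = \<eta> g \<otimes>\<^bsub>RingAutoGroup R\<^esub> \<eta> h"
    using action assms by (auto simp: hom_def)
  also have "\<dots> = compose (carrier R) (\<eta> g) (\<eta> h)"
    using action assms by (intro RingAutoGroup_mult) (auto simp: hom_def RingAutoGroup_def)
  finally show ?thesis using assms by (simp add: compose_def)
qed

text \<open>Membership in \<open>hom\<close> gives multiplicativity only, so the map attached to the
  identity is known to be idempotent; being injective, it fixes every element.\<close>

lemma action_one [simp]:
  assumes "x \<in> carrier R"
  shows "\<eta> \<one>\<^bsub>G\<^esub> x = x"
proof -
  have "\<eta> \<one>\<^bsub>G\<^esub> (\<eta> \<one>\<^bsub>G\<^esub> x) = \<eta> \<one>\<^bsub>G\<^esub> x"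
    using action_mult[of "\<one>\<^bsub>G\<^esub>" "\<one>\<^bsub>G\<^esub>" x] assms by simp
  moreover have "inj_on (\<eta> \<one>\<^bsub>G\<^esub>) (carrier R)"
    using action_automorphism(2)[of "\<one>\<^bsub>G\<^esub>"] by (simp add: bij_betw_def)
  ultimately show ?thesis
    using assms by (auto dest!: inj_onD)
qed

lemma cocycle_Units [simp]: "\<lbrakk>g \<in> carrier G; h \<in> carrier G\<rbrakk> \<Longrightarrow> f g h \<in> Units R"
  using cocycle by (auto simp: two_cocycles_def)

lemma cocycle_closed [simp]: "\<lbrakk>g \<in> carrier G; h \<in> carrier G\<rbrakk> \<Longrightarrow> f g h \<in> carrier R"
  using cocycle_Units by blast

lemma cocycle_eq:
  "\<lbrakk>g \<in> carrier G; h \<in> carrier G; k \<in> carrier G\<rbrakk> \<Longrightarrow>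
    f g h \<otimes> f (g \<otimes>\<^bsub>G\<^esub> h) k = \<eta> g (f h k) \<otimes> f g (h \<otimes>\<^bsub>G\<^esub> k)"
  using cocycle by (auto simp: two_cocycles_def)

text \<open>The cocycle identity at (1, 1, g), with one factor f(1, g) cancelled. Together with its
  mirror image at (g, 1, 1) it takes the place of normalisation.\<close>

lemma cocycle_one_left:
  assumes "g \<in> carrier G"
  shows "f \<one>\<^bsub>G\<^esub> g = f \<one>\<^bsub>G\<^esub> \<one>\<^bsub>G\<^esub>"
  using cocycle_eq[of "\<one>\<^bsub>G\<^esub>" "\<one>\<^bsub>G\<^esub>" g] assms by (simp add: Units_l_cancel m_comm)

lemma cocycle_one_right:
  assumes "g \<in> carrier G"
  shows "f g \<one>\<^bsub>G\<^esub> = \<eta> g (f \<one>\<^bsub>G\<^esub> \<one>\<^bsub>G\<^esub>)"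
  using cocycle_eq[of g "\<one>\<^bsub>G\<^esub>" "\<one>\<^bsub>G\<^esub>"] assms
    Units_l_cancel[of "f g \<one>\<^bsub>G\<^esub>" "f g \<one>\<^bsub>G\<^esub>" "\<eta> g (f \<one>\<^bsub>G\<^esub> \<one>\<^bsub>G\<^esub>)"] by (simp add: m_comm)

lemma
  shows carrier_A: "carrier A = carrier G \<rightarrow>\<^sub>E carrier R"
    and zero_A: "\<zero>\<^bsub>A\<^esub> = (\<lambda>x \<in> carrier G. \<zero>)"
    and add_A: "a \<oplus>\<^bsub>A\<^esub> b = (\<lambda>x \<in> carrier G. a x \<oplus> b x)"
    and mult_A: "a \<otimes>\<^bsub>A\<^esub> b = (\<lambda>x \<in> carrier G.
       finsum R (\<lambda>(g, h). a g \<otimes> \<eta> g (b h) \<otimes> f g h)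
         {(g, h) \<in> carrier G \<times> carrier G. g \<otimes>\<^bsub>G\<^esub> h = x})"
  by (simp_all add: crossed_product_def)

lemma abelian_group_A: "abelian_group A"
proof (rule abelian_groupI)
  fix a b c
  assume "a \<in> carrier A"
  then have a: "a \<in> carrier G \<rightarrow>\<^sub>E carrier R" by (simp add: carrier_A)
  then have [simp]: "a x \<in> carrier R" if "x \<in> carrier G" for x using that by auto
  show "\<zero>\<^bsub>A\<^esub> \<oplus>\<^bsub>A\<^esub> a = a"
    using a by (auto simp: add_A zero_A fun_eq_iff PiE_def extensional_def)
  show "\<exists>b \<in> carrier A. b \<oplus>\<^bsub>A\<^esub> a = \<zero>\<^bsub>A\<^esub>"
    by (rule bexI[of _ "\<lambda>x \<in> carrier G. \<ominus> a x"]) (auto simp: add_A zero_A carrier_A l_neg)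
  assume "b \<in> carrier A"
  then have [simp]: "b x \<in> carrier R" if "x \<in> carrier G" for x using that by (auto simp: carrier_A)
  show "a \<oplus>\<^bsub>A\<^esub> b \<in> carrier A" "a \<oplus>\<^bsub>A\<^esub> b = b \<oplus>\<^bsub>A\<^esub> a"
    by (auto simp: add_A carrier_A a_comm fun_eq_iff)
  assume "c \<in> carrier A"
  then have [simp]: "c x \<in> carrier R" if "x \<in> carrier G" for x using that by (auto simp: carrier_A)
  show "a \<oplus>\<^bsub>A\<^esub> b \<oplus>\<^bsub>A\<^esub> c = a \<oplus>\<^bsub>A\<^esub> (b \<oplus>\<^bsub>A\<^esub> c)"
    by (auto simp: add_A a_assoc fun_eq_iff)
qed (auto simp: zero_A carrier_A)

definition monomial where "monomial b g = (\<lambda>x \<in> carrier G. if x = g then b else \<zero>)"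

lemma monomial_closed [simp]: "b \<in> carrier R \<Longrightarrow> monomial b g \<in> carrier A"
  by (auto simp: monomial_def carrier_A)

lemma monomial_add:
  assumes "a \<in> carrier R" "b \<in> carrier R"
  shows "monomial (a \<oplus> b) g = monomial a g \<oplus>\<^bsub>A\<^esub> monomial b g"
  using assms by (auto simp: monomial_def add_A fun_eq_iff)

lemma one_A: "\<one>\<^bsub>A\<^esub> = monomial (inv (f \<one>\<^bsub>G\<^esub> \<one>\<^bsub>G\<^esub>)) \<one>\<^bsub>G\<^esub>"
  by (simp add: crossed_product_def monomial_def)

text \<open>Truncating \<open>a\<close> to growing subsets of the finite group exhibits it as a sum
  of monomials. Identities that are additive in each argument thereby reduce to monomials.\<close>

lemma crossed_product_induct [consumes 1, case_names monomial add]: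
  assumes "a \<in> carrier A"
    and monomial: "\<And>b g. \<lbrakk>b \<in> carrier R; g \<in> carrier G\<rbrakk> \<Longrightarrow> P (monomial b g)"
    and add: "\<And>x y. \<lbrakk>x \<in> carrier A; y \<in> carrier A; P x; P y\<rbrakk> \<Longrightarrow> P (x \<oplus>\<^bsub>A\<^esub> y)"
  shows "P a"
proof -
  have a: "a \<in> carrier G \<rightarrow>\<^sub>E carrier R" using assms(1) by (simp add: carrier_A)
  have "P (\<lambda>x \<in> carrier G. if x \<in> H then a x else \<zero>)" if "finite H" "H \<subseteq> carrier G" for H
    using that
  proof (induction H rule: finite_induct)
    case empty
    \<comment> \<open>The empty truncation is the zero function, which is itself a monomial with
      coefficient \<open>\<zero>\<close>.\<close>
    show ?case using monomial[OF zero_closed, of "\<one>\<^bsub>G\<^esub>"] by (simp add: monomial_def restrict_def)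
  next
    case (insert g H)
    have eq: "(\<lambda>x \<in> carrier G. if x \<in> insert g H then a x else \<zero>)
        = (\<lambda>x \<in> carrier G. if x \<in> H then a x else \<zero>) \<oplus>\<^bsub>A\<^esub> monomial (a g) g"
      using insert.hyps insert.prems a by (auto simp: add_A monomial_def fun_eq_iff PiE_def Pi_def)
    have g: "a g \<in> carrier R" "g \<in> carrier G" using a insert.prems by auto
    have "(\<lambda>x \<in> carrier G. if x \<in> H then a x else \<zero>) \<in> carrier A"
      using a by (auto simp: carrier_A)
    moreover have "P (\<lambda>x \<in> carrier G. if x \<in> H then a x else \<zero>)"
      by (rule insert.IH) (use insert.prems in simp)
    ultimately show ?case
      unfolding eq using g by (intro add monomial monomial_closed)
  qed
  from this[OF finite_G] have "P (restrict a (carrier G))"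
    by (simp cong: restrict_cong)
  moreover have "restrict a (carrier G) = a" using a by (auto simp: PiE_def extensional_restrict)
  ultimately show ?thesis by simp
qed

lemma finite_pairs: "finite {(g, h) \<in> carrier G \<times> carrier G. g \<otimes>\<^bsub>G\<^esub> h = x}"
  by (rule finite_subset[of _ "carrier G \<times> carrier G"]) (use finite_G in auto)

lemma mult_A_closed:
  assumes "a \<in> carrier A" "b \<in> carrier A"
  shows "a \<otimes>\<^bsub>A\<^esub> b \<in> carrier A"
proof -
  have "a x \<in> carrier R" "b x \<in> carrier R" if "x \<in> carrier G" for x
    using assms that by (auto simp: carrier_A)
  then show ?thesis
    unfolding mult_A unfolding carrier_A by (auto intro!: finsum_closed)
qed

lemma mult_A_distrib:
  assumes "a \<in> carrier A" "b \<in> carrier A" "c \<in> carrier A"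
  shows "(a \<oplus>\<^bsub>A\<^esub> b) \<otimes>\<^bsub>A\<^esub> c = a \<otimes>\<^bsub>A\<^esub> c \<oplus>\<^bsub>A\<^esub> b \<otimes>\<^bsub>A\<^esub> c"
    and "c \<otimes>\<^bsub>A\<^esub> (a \<oplus>\<^bsub>A\<^esub> b) = c \<otimes>\<^bsub>A\<^esub> a \<oplus>\<^bsub>A\<^esub> c \<otimes>\<^bsub>A\<^esub> b"
proof -
  have [simp]: "a x \<in> carrier R" "b x \<in> carrier R" "c x \<in> carrier R" if "x \<in> carrier G" for x
    using assms that by (auto simp: carrier_A)
  let ?P = "\<lambda>x. {(g, h) \<in> carrier G \<times> carrier G. g \<otimes>\<^bsub>G\<^esub> h = x}"
  show "(a \<oplus>\<^bsub>A\<^esub> b) \<otimes>\<^bsub>A\<^esub> c = a \<otimes>\<^bsub>A\<^esub> c \<oplus>\<^bsub>A\<^esub> b \<otimes>\<^bsub>A\<^esub> c"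
  proof
    fix x
    have "finsum R (\<lambda>(g, h). (a \<oplus>\<^bsub>A\<^esub> b) g \<otimes> \<eta> g (c h) \<otimes> f g h) (?P x)
      = finsum R (\<lambda>p. (case p of (g, h) \<Rightarrow> a g \<otimes> \<eta> g (c h) \<otimes> f g h)
          \<oplus> (case p of (g, h) \<Rightarrow> b g \<otimes> \<eta> g (c h) \<otimes> f g h)) (?P x)"
      by (rule finsum_cong') (auto simp: add_A l_distr)
    also have "\<dots> = finsum R (\<lambda>(g, h). a g \<otimes> \<eta> g (c h) \<otimes> f g h) (?P x)
        \<oplus> finsum R (\<lambda>(g, h). b g \<otimes> \<eta> g (c h) \<otimes> f g h) (?P x)"
      by (rule finsum_addf) auto
    finally show "((a \<oplus>\<^bsub>A\<^esub> b) \<otimes>\<^bsub>A\<^esub> c) x = (a \<otimes>\<^bsub>A\<^esub> c \<oplus>\<^bsub>A\<^esub> b \<otimes>\<^bsub>A\<^esub> c) x"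
      unfolding mult_A add_A[of "restrict _ _" "restrict _ _"] by simp
  qed
  show "c \<otimes>\<^bsub>A\<^esub> (a \<oplus>\<^bsub>A\<^esub> b) = c \<otimes>\<^bsub>A\<^esub> a \<oplus>\<^bsub>A\<^esub> c \<otimes>\<^bsub>A\<^esub> b"
  proof
    fix x
    have "finsum R (\<lambda>(g, h). c g \<otimes> \<eta> g ((a \<oplus>\<^bsub>A\<^esub> b) h) \<otimes> f g h) (?P x)
      = finsum R (\<lambda>p. (case p of (g, h) \<Rightarrow> c g \<otimes> \<eta> g (a h) \<otimes> f g h)
          \<oplus> (case p of (g, h) \<Rightarrow> c g \<otimes> \<eta> g (b h) \<otimes> f g h)) (?P x)"
      by (rule finsum_cong') (auto simp: add_A l_distr r_distr)
    also have "\<dots> = finsum R (\<lambda>(g, h). c g \<otimes> \<eta> g (a h) \<otimes> f g h) (?P x)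
        \<oplus> finsum R (\<lambda>(g, h). c g \<otimes> \<eta> g (b h) \<otimes> f g h) (?P x)"
      by (rule finsum_addf) auto
    finally show "(c \<otimes>\<^bsub>A\<^esub> (a \<oplus>\<^bsub>A\<^esub> b)) x = (c \<otimes>\<^bsub>A\<^esub> a \<oplus>\<^bsub>A\<^esub> c \<otimes>\<^bsub>A\<^esub> b) x"
      unfolding mult_A add_A[of "restrict _ _" "restrict _ _"] by simp
  qed
qed

lemma monomial_mult:
  assumes "a \<in> carrier R" "g \<in> carrier G" "b \<in> carrier R" "h \<in> carrier G"
  shows "monomial a g \<otimes>\<^bsub>A\<^esub> monomial b h = monomial (a \<otimes> \<eta> g b \<otimes> f g h) (g \<otimes>\<^bsub>G\<^esub> h)"
proof
  fix x
  let ?P = "{(g, h) \<in> carrier G \<times> carrier G. g \<otimes>\<^bsub>G\<^esub> h = x}"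
  let ?t = "\<lambda>_. a \<otimes> \<eta> g b \<otimes> f g h"
  have t: "a \<otimes> \<eta> g b \<otimes> f g h \<in> carrier R" using assms by simp
  have "finsum R (\<lambda>(g', h'). monomial a g g' \<otimes> \<eta> g' (monomial b h h') \<otimes> f g' h') ?P
      = finsum R (\<lambda>p. if (g, h) = p then ?t p else \<zero>) ?P"
    using assms by (intro finsum_cong') (auto simp: monomial_def split: if_splits)
  also have "\<dots> = (if x = g \<otimes>\<^bsub>G\<^esub> h then a \<otimes> \<eta> g b \<otimes> f g h else \<zero>)"
  proof (cases "x = g \<otimes>\<^bsub>G\<^esub> h")
    case True
    then show ?thesis
      using finsum_singleton[OF _ finite_pairs, of "(g, h)" x ?t] assms t by simp
  next
    case False
    then show ?thesis
      by (auto intro!: add.finprod_one_eqI)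
  qed
  finally show "(monomial a g \<otimes>\<^bsub>A\<^esub> monomial b h) x = monomial (a \<otimes> \<eta> g b \<otimes> f g h) (g \<otimes>\<^bsub>G\<^esub> h) x"
    unfolding mult_A by (simp add: monomial_def[of "a \<otimes> \<eta> g b \<otimes> f g h"])
qed

text \<open>This is the cocycle identity multiplied by the common factor a g(b) gh(c); commutativity
  of \<open>R\<close> allows the factors to be collected.\<close>

lemma monomial_assoc:
  assumes "a \<in> carrier R" "g \<in> carrier G" "b \<in> carrier R" "h \<in> carrier G" "c \<in> carrier R" "k \<in> carrier G"
  shows "monomial a g \<otimes>\<^bsub>A\<^esub> monomial b h \<otimes>\<^bsub>A\<^esub> monomial c k =
    monomial a g \<otimes>\<^bsub>A\<^esub> (monomial b h \<otimes>\<^bsub>A\<^esub> monomial c k)"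
proof -
  have "a \<otimes> \<eta> g b \<otimes> f g h \<otimes> \<eta> (g \<otimes>\<^bsub>G\<^esub> h) c \<otimes> f (g \<otimes>\<^bsub>G\<^esub> h) k
      = a \<otimes> \<eta> g b \<otimes> \<eta> g (\<eta> h c) \<otimes> (f g h \<otimes> f (g \<otimes>\<^bsub>G\<^esub> h) k)"
    using assms by (simp add: action_mult m_ac)
  also have "\<dots> = a \<otimes> \<eta> g (b \<otimes> \<eta> h c \<otimes> f h k) \<otimes> f g (h \<otimes>\<^bsub>G\<^esub> k)"
    using assms by (simp add: cocycle_eq m_ac)
  finally show ?thesis
    using assms by (simp add: monomial_mult G.m_assoc)
qed

lemma mult_A_assoc:
  assumes "a \<in> carrier A" "b \<in> carrier A" "c \<in> carrier A"
  shows "a \<otimes>\<^bsub>A\<^esub> b \<otimes>\<^bsub>A\<^esub> c = a \<otimes>\<^bsub>A\<^esub> (b \<otimes>\<^bsub>A\<^esub> c)"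
  using assms
proof (induction a arbitrary: b c rule: crossed_product_induct)
  case (monomial a g b c)
  from monomial(3,1,2,4) show ?case
  proof (induction b arbitrary: c rule: crossed_product_induct)
    case (monomial b h c)
    from monomial(5,1-4) show ?case
      by (induction c rule: crossed_product_induct)
        (auto simp: monomial_assoc mult_A_distrib mult_A_closed)
  qed (auto simp: mult_A_distrib mult_A_closed)
qed (auto simp: mult_A_distrib mult_A_closed)

text \<open>The map sending \<open>b\<close> to \<open>b\<close> times the identity of
  \<open>A\<close>. Without the factor \<open>inv (f 1 1)\<close> it would in general fail to be
  multiplicative, as \<open>u_1\<close> squares to \<open>f(1,1) u_1\<close>.\<close>

definition embed where "embed b = monomial (b \<otimes> inv (f \<one>\<^bsub>G\<^esub> \<one>\<^bsub>G\<^esub>)) \<one>\<^bsub>G\<^esub>"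

lemma embed_closed [simp]: "b \<in> carrier R \<Longrightarrow> embed b \<in> carrier A"
  by (simp add: embed_def)

lemma embed_monomial:
  assumes "b \<in> carrier R" "c \<in> carrier R" "h \<in> carrier G"
  shows "embed b \<otimes>\<^bsub>A\<^esub> monomial c h = monomial (b \<otimes> c) h"
proof -
  have "b \<otimes> inv (f \<one>\<^bsub>G\<^esub> \<one>\<^bsub>G\<^esub>) \<otimes> c \<otimes> f \<one>\<^bsub>G\<^esub> \<one>\<^bsub>G\<^esub>
      = b \<otimes> c \<otimes> (inv (f \<one>\<^bsub>G\<^esub> \<one>\<^bsub>G\<^esub>) \<otimes> f \<one>\<^bsub>G\<^esub> \<one>\<^bsub>G\<^esub>)"
    using assms by (simp add: m_ac del: Units_l_inv)
  then show ?thesis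
    using assms by (simp add: embed_def monomial_mult cocycle_one_left[of h])
qed

text \<open>The commutation rule u_h b = h(b) u_h of crossed products. The correction inside
  \<open>embed\<close> is hit by h, and so is the value f(h, 1) = h(f(1, 1)), so that they
  cancel.\<close>

lemma monomial_embed:
  assumes "b \<in> carrier R" "c \<in> carrier R" "h \<in> carrier G"
  shows "monomial c h \<otimes>\<^bsub>A\<^esub> embed b = monomial (c \<otimes> \<eta> h b) h"
proof -
  have "c \<otimes> (\<eta> h b \<otimes> \<eta> h (inv (f \<one>\<^bsub>G\<^esub> \<one>\<^bsub>G\<^esub>))) \<otimes> \<eta> h (f \<one>\<^bsub>G\<^esub> \<one>\<^bsub>G\<^esub>)
      = c \<otimes> \<eta> h b \<otimes> \<eta> h (inv (f \<one>\<^bsub>G\<^esub> \<one>\<^bsub>G\<^esub>) \<otimes> f \<one>\<^bsub>G\<^esub> \<one>\<^bsub>G\<^esub>)"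
    using assms by (simp add: m_assoc del: Units_l_inv)
  then show ?thesis
    using assms by (simp add: embed_def monomial_mult cocycle_one_right[of h])
qed

lemma embed_one: "embed \<one> = \<one>\<^bsub>A\<^esub>"
  by (simp add: embed_def one_A)

lemma ring_A: "ring A"
proof (intro ringI abelian_group_A)
  have one: "\<one>\<^bsub>A\<^esub> \<in> carrier A" by (simp flip: embed_one)
  have "\<one>\<^bsub>A\<^esub> \<otimes>\<^bsub>A\<^esub> x = x" "x \<otimes>\<^bsub>A\<^esub> \<one>\<^bsub>A\<^esub> = x" if "x \<in> carrier A" for x
    using that one
    by (induction x rule: crossed_product_induct)
      (simp_all add: mult_A_distrib, simp_all add: embed_monomial monomial_embed flip: embed_one)
  then show "monoid A"
    using one by unfold_locales (auto intro: mult_A_closed mult_A_assoc)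
qed (auto simp: mult_A_distrib)

sublocale A: ring A
  by (rule ring_A)

lemma embed_hom: "embed \<in> ring_hom R A"
proof (rule ring_hom_memI)
  show "embed (x \<otimes> y) = embed x \<otimes>\<^bsub>A\<^esub> embed y" if "x \<in> carrier R" "y \<in> carrier R" for x y
    using embed_monomial[of x "y \<otimes> inv (f \<one>\<^bsub>G\<^esub> \<one>\<^bsub>G\<^esub>)" "\<one>\<^bsub>G\<^esub>"] that by (simp add: embed_def m_assoc)
  show "embed (x \<oplus> y) = embed x \<oplus>\<^bsub>A\<^esub> embed y" if "x \<in> carrier R" "y \<in> carrier R" for x y
    using that by (simp add: embed_def l_distr monomial_add)
qed (simp_all add: embed_one)

sublocale embed: ring_hom_ring R A embed
  by (intro ring_hom_ringI2 ring_axioms ring_A embed_hom)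

lemma embed_eqD:
  assumes "embed a = embed b" "a \<in> carrier R" "b \<in> carrier R"
  shows "a = b"
proof -
  have "embed a \<one>\<^bsub>G\<^esub> = embed b \<one>\<^bsub>G\<^esub>" using assms by simp
  then have "a \<otimes> inv (f \<one>\<^bsub>G\<^esub> \<one>\<^bsub>G\<^esub>) = b \<otimes> inv (f \<one>\<^bsub>G\<^esub> \<one>\<^bsub>G\<^esub>)"
    by (simp add: embed_def monomial_def)
  then have "a \<otimes> (inv (f \<one>\<^bsub>G\<^esub> \<one>\<^bsub>G\<^esub>) \<otimes> f \<one>\<^bsub>G\<^esub> \<one>\<^bsub>G\<^esub>) = b \<otimes> (inv (f \<one>\<^bsub>G\<^esub> \<one>\<^bsub>G\<^esub>) \<otimes> f \<one>\<^bsub>G\<^esub> \<one>\<^bsub>G\<^esub>)"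
    using assms by (simp add: m_assoc[symmetric] del: Units_l_inv)
  then show ?thesis using assms by simp
qed

text \<open>With g' the inverse of g, the product u_g' u_g is f(g', g) u_1, that is f(g', g) f(1, 1)
  times the identity; this dictates \<open>?c\<close> for a left inverse. That it is also a right
  inverse comes from the cocycle identity at (g, g', g), which expresses f(g, g') through g(f(g',
  g)).\<close>

lemma monomial_Units:
  assumes "g \<in> carrier G"
  shows "monomial \<one> g \<in> Units A"
proof -
  let ?g' = "inv\<^bsub>G\<^esub> g" and ?e = "f \<one>\<^bsub>G\<^esub> \<one>\<^bsub>G\<^esub>"
  let ?c = "inv ?e \<otimes> inv (f ?g' g)"
  have c: "?c \<in> carrier R" using assms by simp
  have "monomial ?c ?g' \<otimes>\<^bsub>A\<^esub> monomial \<one> g = \<one>\<^bsub>A\<^esub>"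
    using assms by (simp add: monomial_mult one_A m_assoc)
  moreover have "monomial \<one> g \<otimes>\<^bsub>A\<^esub> monomial ?c ?g' = \<one>\<^bsub>A\<^esub>"
  proof -
    have "\<eta> g ?c \<otimes> f g ?g' \<otimes> ?e = \<eta> g ?c \<otimes> (\<eta> g (f ?g' g) \<otimes> \<eta> g ?e)"
      using cocycle_eq[of g ?g' g] cocycle_one_left[OF assms] cocycle_one_right[OF assms] assms
      by (simp add: m_assoc)
    also have "\<dots> = \<eta> g (?c \<otimes> (f ?g' g \<otimes> ?e))"
      using assms by simp
    also have "?c \<otimes> (f ?g' g \<otimes> ?e) = (inv ?e \<otimes> ?e) \<otimes> (inv (f ?g' g) \<otimes> f ?g' g)"
      using assms by (simp add: m_ac del: Units_l_inv)
    finally have "\<eta> g ?c \<otimes> f g ?g' \<otimes> ?e = \<one>"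
      using assms by simp
    then have "\<eta> g ?c \<otimes> f g ?g' = inv ?e"
      using assms c by (intro comm_inv_char[symmetric]) (auto simp: m_comm)
    then show ?thesis using assms c by (simp add: monomial_mult one_A)
  qed
  ultimately show ?thesis
    using c unfolding Units_def[of A] by (auto intro!: bexI[of _ "monomial ?c ?g'"])
qed

end

section \<open>A Maschke argument\<close>

lemma (in ring) left_ideal_finsum:
  assumes "left_ideal I R" "\<And>x. x \<in> B \<Longrightarrow> h x \<in> I"
  shows "finsum R h B \<in> I"
  using assms(2)
proof (induction B rule: infinite_finite_induct)
  case (insert x B)
  then have "h \<in> B \<rightarrow> carrier R" "h x \<in> carrier R"
    using left_idealD(1)[OF assms(1)] by blast+
  then show ?case
    using insert left_idealD(3)[OF assms(1)] by simp
qed (simp_all add: left_idealD(2)[OF assms(1)])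

text \<open>\<open>R\<close> is viewed as a vector space over \<open>K\<close> by left
  multiplication. Among the subspaces meeting \<open>I\<close> trivially one of greatest cardinality
  is a complement of \<open>I\<close>, and \<pi> is the projection along it.\<close>

lemma (in ring) left_ideal_projection:
  assumes fin: "finite (carrier R)" and K: "subfield K R" and I: "left_ideal I R"
  obtains \<pi> where
    "\<And>x. x \<in> carrier R \<Longrightarrow> \<pi> x \<in> I"
    "\<And>x y. \<lbrakk>x \<in> carrier R; y \<in> carrier R\<rbrakk> \<Longrightarrow> \<pi> (x \<oplus> y) = \<pi> x \<oplus> \<pi> y"
    "\<And>k x. \<lbrakk>k \<in> K; x \<in> carrier R\<rbrakk> \<Longrightarrow> \<pi> (k \<otimes> x) = k \<otimes> \<pi> x"
    "\<And>x. x \<in> I \<Longrightarrow> \<pi> x = x"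
proof -
  note Ks = subringE[OF subfieldE(1)[OF K]]
  note Id = left_idealD[OF I]
  define V where "V W \<longleftrightarrow> W \<subseteq> carrier R \<and> \<zero> \<in> W \<and> (\<forall>x \<in> W. \<forall>y \<in> W. x \<oplus> y \<in> W) \<and>
    (\<forall>k \<in> K. \<forall>x \<in> W. k \<otimes> x \<in> W) \<and> W \<inter> I = {\<zero>}" for W
  have "V {\<zero>}" using Ks(1) Id(2) by (auto simp: V_def)
  moreover have "card W < Suc (card (carrier R))" if "V W" for W
    using that fin by (auto simp: V_def less_Suc_eq_le intro: card_mono)
  ultimately obtain W where W: "V W" and max: "\<And>W'. V W' \<Longrightarrow> card W' \<le> card W"
    using ex_has_greatest_nat[of V "{\<zero>}" card] by blast
  have Wc: "W \<subseteq> carrier R" and W0: "\<zero> \<in> W" and WI: "W \<inter> I = {\<zero>}"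
    and Wa: "\<And>x y. \<lbrakk>x \<in> W; y \<in> W\<rbrakk> \<Longrightarrow> x \<oplus> y \<in> W"
    and Wm: "\<And>k x. \<lbrakk>k \<in> K; x \<in> W\<rbrakk> \<Longrightarrow> k \<otimes> x \<in> W"
    using W by (auto simp: V_def)
  have Wn: "\<ominus> x \<in> W" if "x \<in> W" for x
    using Wm[OF Ks(5)[OF Ks(3)] that] that Wc by (auto simp: l_minus)
  have ex: "\<exists>i. i \<in> I \<and> x \<ominus> i \<in> W" if x: "x \<in> carrier R" for x
  proof (rule ccontr)
    assume no: "\<not> ?thesis"
    \<comment> \<open>The span of \<open>W\<close> and \<open>x\<close>. If \<open>x\<close> were
      outside \<open>I + W\<close>, this larger subspace would still meet \<open>I\<close>
      trivially, against the choice of \<open>W\<close>.\<close>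
    define W' where "W' = {w \<oplus> k \<otimes> x | w k. w \<in> W \<and> k \<in> K}"
    have sub: "W \<subseteq> W'"
    proof
      fix w assume "w \<in> W"
      moreover from this have "w = w \<oplus> \<zero> \<otimes> x" using Wc x by auto
      ultimately show "w \<in> W'" unfolding W'_def using Ks(2) by blast
    qed
    have "\<zero> \<oplus> \<one> \<otimes> x \<in> W'" unfolding W'_def using Ks(3) W0 by blast
    then have "x \<in> W'" using x by simp
    moreover have "x \<notin> W" using no Id(2) x by (auto simp: minus_eq)
    moreover have W'c: "W' \<subseteq> carrier R"
      using Wc Ks(1) x by (auto simp: W'_def)
    moreover have "finite W'" using finite_subset[OF W'c fin] .
    ultimately have "card W < card W'" using sub by (intro psubset_card_mono) auto
    moreover have "V W'"
      unfolding V_def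
    proof (intro conjI ballI)
      show "W' \<subseteq> carrier R" by fact
      show "\<zero> \<in> W'" using W0 sub by auto
      show "y \<oplus> z \<in> W'" if yz: "y \<in> W'" "z \<in> W'" for y z
      proof -
        obtain w k w' k' where *: "w \<in> W" "k \<in> K" "w' \<in> W" "k' \<in> K"
            "y = w \<oplus> k \<otimes> x" "z = w' \<oplus> k' \<otimes> x"
          using yz unfolding W'_def by blast
        then have "{w, k, w', k'} \<subseteq> carrier R" using Wc Ks(1) by auto
        then have "y \<oplus> z = (w \<oplus> w') \<oplus> (k \<oplus> k') \<otimes> x"
          using * x by (simp add: l_distr a_ac)
        then show ?thesis using * Wa Ks(7) unfolding W'_def by blast
      qed
      show "l \<otimes> y \<in> W'" if ly: "l \<in> K" "y \<in> W'" for l y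
      proof -
        obtain w k where *: "w \<in> W" "k \<in> K" "y = w \<oplus> k \<otimes> x"
          using ly unfolding W'_def by blast
        then have "{w, k, l} \<subseteq> carrier R" using Wc Ks(1) ly by auto
        then have "l \<otimes> y = l \<otimes> w \<oplus> (l \<otimes> k) \<otimes> x"
          using * x by (simp add: r_distr m_assoc)
        then show ?thesis using * Wm Ks(6) ly unfolding W'_def by blast
      qed
      have "y = \<zero>" if y: "y \<in> W'" "y \<in> I" for y
      proof -
        obtain w k where *: "w \<in> W" "k \<in> K" "y = w \<oplus> k \<otimes> x"
          using y unfolding W'_def by blast
        then have c: "w \<in> carrier R" "k \<in> carrier R" using Wc Ks(1) by auto
        show ?thesis
        proof (cases "k = \<zero>")
          case True
          then show ?thesis using * c x y(2) WI by auto
        next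
          case False
          then have k: "inv k \<in> K" "inv k \<otimes> k = \<one>"
            using subfield_m_inv[OF K, of k] *(2) by auto
          \<comment> \<open>Dividing \<open>y\<close> by \<open>k\<close> solves for
            \<open>x\<close> modulo \<open>I\<close>: the difference of \<open>x\<close> and
            \<open>inv k \<otimes> y\<close> is in \<open>W\<close>, which \<open>no\<close>
            forbids.\<close>
          then have kc: "inv k \<in> carrier R" using Ks(1) by auto
          have "inv k \<otimes> y = inv k \<otimes> w \<oplus> inv k \<otimes> k \<otimes> x"
            unfolding *(3) using kc c x by (simp add: r_distr m_assoc)
          also have "\<dots> = inv k \<otimes> w \<oplus> x" using k(2) x by simp
          finally have "x \<ominus> inv k \<otimes> y = x \<oplus> (\<ominus> x \<oplus> \<ominus> (inv k \<otimes> w))"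
            using kc c x by (simp add: minus_eq minus_add a_comm)
          also have "\<dots> = \<ominus> (inv k \<otimes> w)"
            using kc c x by (simp add: r_neg2)
          finally show ?thesis
            using no Id(4)[OF kc y(2)] Wn[OF Wm[OF k(1) *(1)]] by auto
        qed
      qed
      then show "W' \<inter> I = {\<zero>}" using W0 sub Id(2) by blast
    qed
    ultimately show False using max[of W'] by simp
  qed
  have unique: "i = j" if "i \<in> I" "j \<in> I" "x \<in> carrier R" "x \<ominus> i \<in> W" "x \<ominus> j \<in> W" for i j x
  proof -
    have c: "i \<in> carrier R" "j \<in> carrier R" using that Id(1) by auto
    have "(x \<ominus> i) \<oplus> \<ominus> (x \<ominus> j) = j \<ominus> i"
      using c that(3) by algebra
    then have "j \<ominus> i \<in> W \<inter> I"
      using Wa[OF that(4) Wn[OF that(5)]] Id(6)[OF that(2,1)] by simp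
    then have "j \<ominus> i = \<zero>" using WI by blast
    then show ?thesis using c by (simp add: r_right_minus_eq)
  qed
  \<comment> \<open>The choice is forced by \<open>unique\<close>, and this is what makes \<pi>
    additive and linear.\<close>
  define \<pi> where "\<pi> x = (SOME i. i \<in> I \<and> x \<ominus> i \<in> W)" for x
  have \<pi>: "\<pi> x \<in> I" "x \<ominus> \<pi> x \<in> W" if "x \<in> carrier R" for x
    using someI_ex[OF ex[OF that]] unfolding \<pi>_def by auto
  have \<pi>I: "\<pi> x = i" if "x \<in> carrier R" "i \<in> I" "x \<ominus> i \<in> W" for x i
    using unique[OF \<pi>(1)[OF that(1)] that(2,1) \<pi>(2)[OF that(1)] that(3)] .
  have \<pi>c: "\<pi> x \<in> carrier R" if "x \<in> carrier R" for x
    using \<pi>(1)[OF that] Id(1) by auto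
  show thesis
  proof
    show "\<pi> x \<in> I" if "x \<in> carrier R" for x by (rule \<pi>(1)[OF that])
    show "\<pi> (x \<oplus> y) = \<pi> x \<oplus> \<pi> y" if xy: "x \<in> carrier R" "y \<in> carrier R" for x y
    proof (rule \<pi>I)
      have "(x \<oplus> y) \<ominus> (\<pi> x \<oplus> \<pi> y) = (x \<ominus> \<pi> x) \<oplus> (y \<ominus> \<pi> y)"
        using xy \<pi>c[OF xy(1)] \<pi>c[OF xy(2)] by algebra
      then show "(x \<oplus> y) \<ominus> (\<pi> x \<oplus> \<pi> y) \<in> W"
        using Wa \<pi>(2) xy by simp
    qed (use xy \<pi>(1) Id(3) in auto)
    show "\<pi> (k \<otimes> x) = k \<otimes> \<pi> x" if kx: "k \<in> K" "x \<in> carrier R" for k x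
    proof (rule \<pi>I)
      have k: "k \<in> carrier R" using kx Ks(1) by auto
      have "k \<otimes> x \<ominus> k \<otimes> \<pi> x = k \<otimes> (x \<ominus> \<pi> x)"
        using k kx \<pi>c[OF kx(2)] by (simp add: minus_eq r_distr r_minus)
      then show "k \<otimes> x \<ominus> k \<otimes> \<pi> x \<in> W" using Wm \<pi>(2) kx by simp
      show "k \<otimes> x \<in> carrier R" "k \<otimes> \<pi> x \<in> I" using k kx Id(4) \<pi>(1) by auto
    qed
    show "\<pi> x = x" if "x \<in> I" for x
      using that Id(1) W0 by (intro \<pi>I) (auto simp: minus_eq r_neg)
  qed
qed

context crossed_product_datum
begin

section \<open>Translation of sums over the group, and the trace\<close>

lemma embed_finsum:
  "h \<in> B \<rightarrow> carrier R \<Longrightarrow> embed (finsum R h B) = finsum A (\<lambda>x. embed (h x)) B"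
  by (simp add: comp_def)

lemma finite_carrier_A: "finite (carrier R) \<Longrightarrow> finite (carrier A)"
  using finite_G by (simp add: carrier_A finite_PiE)

text \<open>Left translation permutes the group. The target \<open>S\<close> is left general because
  the argument is used in \<open>R\<close> for the trace and in \<open>A\<close> for the averaged
  projection.\<close>

lemma sum_translate:
  assumes "h \<in> carrier G" "t \<in> carrier G \<rightarrow> carrier S" "abelian_group S"
  shows "(\<Oplus>\<^bsub>S\<^esub>g \<in> carrier G. t (h \<otimes>\<^bsub>G\<^esub> g)) = finsum S t (carrier G)"
proof -
  interpret S: abelian_group S by fact
  have "finsum S t ((\<otimes>\<^bsub>G\<^esub>) h ` carrier G) = (\<Oplus>\<^bsub>S\<^esub>g \<in> carrier G. t (h \<otimes>\<^bsub>G\<^esub> g))"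
    using assms by (intro S.finsum_reindex) (auto simp: G.inj_on_cmult)
  then show ?thesis
    using assms(1) by (simp add: G.surj_const_mult)
qed

text \<open>The action need not be faithful: over a field this is the Galois trace to the fixed
  field, multiplied by the order of the kernel of the action.\<close>

definition trace where "trace c = (\<Oplus>g \<in> carrier G. \<eta> g c)"

lemma trace_closed: "c \<in> carrier R \<Longrightarrow> trace c \<in> carrier R"
  unfolding trace_def by (rule finsum_closed) auto

lemma action_finsum:
  assumes "h \<in> carrier G" "t \<in> B \<rightarrow> carrier R"
  shows "\<eta> h (finsum R t B) = (\<Oplus>x \<in> B. \<eta> h (t x))"
proof -
  interpret ring_hom_ring R R "\<eta> h"
    by (intro ring_hom_ringI2 ring_axioms action_automorphism assms(1))
  show ?thesis using assms(2) by (simp add: comp_def)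
qed

lemma trace_fixed:
  assumes "c \<in> carrier R" "h \<in> carrier G"
  shows "\<eta> h (trace c) = trace c"
proof -
  have "\<eta> h (trace c) = (\<Oplus>g \<in> carrier G. \<eta> h (\<eta> g c))"
    unfolding trace_def using assms by (intro action_finsum) auto
  also have "\<dots> = (\<Oplus>g \<in> carrier G. \<eta> (h \<otimes>\<^bsub>G\<^esub> g) c)"
    using assms by (intro finsum_cong') (auto simp: action_mult)
  also have "\<dots> = trace c"
    unfolding trace_def using assms by (intro sum_translate) (auto intro: abelian_group_axioms)
  finally show ?thesis .
qed

text \<open>A nonzero trace is fixed by the group, hence so is its inverse, which can therefore be
  pulled out of the trace of \<open>c \<otimes> inv ?t\<close>.\<close>

lemma trace_one_exists:
  assumes "field R" "c \<in> carrier R" "trace c \<noteq> \<zero>"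
  obtains d where "d \<in> carrier R" "trace d = \<one>"
proof
  let ?t = "trace c"
  have t: "?t \<in> Units R" "?t \<in> carrier R"
    using field.field_Units[OF assms(1)] assms trace_closed by auto
  have "\<eta> g (inv ?t) = inv ?t" if "g \<in> carrier G" for g
  proof -
    have "\<eta> g (inv ?t) \<otimes> ?t = \<eta> g (inv ?t \<otimes> ?t)"
      using that t assms(2) by (simp add: trace_fixed del: Units_l_inv)
    then have "\<eta> g (inv ?t) \<otimes> ?t = \<one>"
      using that t by simp
    then show ?thesis
      using that t by (intro comm_inv_char[symmetric]) (auto simp: m_comm)
  qed
  then have "trace (c \<otimes> inv ?t) = (\<Oplus>g \<in> carrier G. \<eta> g c \<otimes> inv ?t)"
    unfolding trace_def[of "c \<otimes> inv ?t"] using assms(2) t by (intro finsum_cong') auto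
  also have "\<dots> = ?t \<otimes> inv ?t"
    using finsum_ldistr[OF finite_G Units_inv_closed[OF t(1)], of "\<lambda>g. \<eta> g c"] assms(2)
    unfolding trace_def[of c] by auto
  finally show "trace (c \<otimes> inv ?t) = \<one>" using t by simp
  show "c \<otimes> inv ?t \<in> carrier R" using t assms by simp
qed

text \<open>As in Maschke's theorem, a linear projection \<open>\<pi>\<close> onto \<open>I\<close> is averaged over the group; the
  weight \<open>c\<close> of trace one plays the role of the inverse of the group order.\<close>

lemma left_ideal_complement:
  assumes R: "field R" and fin: "finite (carrier R)"
    and c: "c \<in> carrier R" "trace c = \<one>" and I: "left_ideal I A"
  shows "\<exists>J. left_ideal J A \<and> I \<inter> J = {\<zero>\<^bsub>A\<^esub>} \<and> I <+>\<^bsub>A\<^esub> J = carrier A"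
proof -
  have "\<one>\<^bsub>A\<^esub> \<noteq> \<zero>\<^bsub>A\<^esub>"
    using embed_eqD[of \<one> \<zero>] domain.one_not_zero[OF field.axioms(1)[OF R]] by auto
  then have K: "subfield (embed ` carrier R) A"
    by (intro embed.img_is_subfield field.carrier_is_subfield R)
  note Id = A.left_idealD[OF I]
  obtain \<pi> where \<pi>I: "\<And>x. x \<in> carrier A \<Longrightarrow> \<pi> x \<in> I"
    and \<pi>add: "\<And>x y. \<lbrakk>x \<in> carrier A; y \<in> carrier A\<rbrakk> \<Longrightarrow> \<pi> (x \<oplus>\<^bsub>A\<^esub> y) = \<pi> x \<oplus>\<^bsub>A\<^esub> \<pi> y"
    and \<pi>lin: "\<And>k x. \<lbrakk>k \<in> embed ` carrier R; x \<in> carrier A\<rbrakk> \<Longrightarrow> \<pi> (k \<otimes>\<^bsub>A\<^esub> x) = k \<otimes>\<^bsub>A\<^esub> \<pi> x"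
    and \<pi>id: "\<And>x. x \<in> I \<Longrightarrow> \<pi> x = x"
    using A.left_ideal_projection[OF finite_carrier_A[OF fin] K I] by blast
  have \<pi>c [simp]: "\<pi> x \<in> carrier A" if "x \<in> carrier A" for x
    using \<pi>I[OF that] Id(1) by auto
  define u where "u = monomial \<one>"
  define v where "v g = inv\<^bsub>A\<^esub> u g" for g
  have u: "u g \<in> Units A" if "g \<in> carrier G" for g
    using monomial_Units[OF that] by (simp add: u_def)
  have uvc [simp]: "u g \<in> carrier A" "v g \<in> carrier A"
    and uv [simp]: "u g \<otimes>\<^bsub>A\<^esub> v g = \<one>\<^bsub>A\<^esub>" "v g \<otimes>\<^bsub>A\<^esub> u g = \<one>\<^bsub>A\<^esub>"
    if "g \<in> carrier G" for g
    using u[OF that] by (auto simp: v_def)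
  \<comment> \<open>Moving \<open>c\<close> to the left past \<open>u g\<close> turns it into \<eta>
    g c, so on \<open>I\<close> the terms add up to \<open>trace c\<close> times the
    argument.\<close>
  define S where "S x g = u g \<otimes>\<^bsub>A\<^esub> embed c \<otimes>\<^bsub>A\<^esub> \<pi> (v g \<otimes>\<^bsub>A\<^esub> x)" for x g
  have S [simp]: "S x g \<in> carrier A" if "x \<in> carrier A" "g \<in> carrier G" for x g
    using that c by (simp add: S_def)
  define T where "T x = finsum A (S x) (carrier G)" for x
  have TI: "T x \<in> I" if "x \<in> carrier A" for x
    unfolding T_def using that c by (intro A.left_ideal_finsum[OF I]) (simp add: S_def \<pi>I Id(4))
  have Tc [simp]: "T x \<in> carrier A" if "x \<in> carrier A" for x
    using TI[OF that] Id(1) by auto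
  have Tadd: "T (x \<oplus>\<^bsub>A\<^esub> y) = T x \<oplus>\<^bsub>A\<^esub> T y" if "x \<in> carrier A" "y \<in> carrier A" for x y
  proof -
    have "T (x \<oplus>\<^bsub>A\<^esub> y) = (\<Oplus>\<^bsub>A\<^esub>g \<in> carrier G. S x g \<oplus>\<^bsub>A\<^esub> S y g)"
      unfolding T_def using that c
      by (intro A.finsum_cong') (auto simp: S_def A.r_distr \<pi>add)
    then show ?thesis
      unfolding T_def using that by (simp add: A.finsum_addf)
  qed
  have Tid: "T x = x" if "x \<in> I" for x
  proof -
    have x: "x \<in> carrier A" using that Id(1) by auto
    have "S x g = embed (\<eta> g c) \<otimes>\<^bsub>A\<^esub> x" if g: "g \<in> carrier G" for g
    proof -
      have "u g \<otimes>\<^bsub>A\<^esub> embed c = embed (\<eta> g c) \<otimes>\<^bsub>A\<^esub> u g"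
        using g c by (simp add: u_def monomial_embed embed_monomial)
      moreover have "\<pi> (v g \<otimes>\<^bsub>A\<^esub> x) = v g \<otimes>\<^bsub>A\<^esub> x"
        using g \<open>x \<in> I\<close> by (intro \<pi>id Id(4)) auto
      ultimately have "S x g = embed (\<eta> g c) \<otimes>\<^bsub>A\<^esub> ((u g \<otimes>\<^bsub>A\<^esub> v g) \<otimes>\<^bsub>A\<^esub> x)"
        unfolding S_def using g c x
        by (simp add: A.m_assoc del: uv)
      then show ?thesis using g x by simp
    qed
    then have "T x = (\<Oplus>\<^bsub>A\<^esub>g \<in> carrier G. embed (\<eta> g c) \<otimes>\<^bsub>A\<^esub> x)"
      unfolding T_def using c x by (intro A.finsum_cong') auto
    also have "\<dots> = embed (trace c) \<otimes>\<^bsub>A\<^esub> x"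
      unfolding trace_def using c x finite_G
      by (subst embed_finsum) (auto intro!: A.finsum_ldistr[symmetric])
    finally show ?thesis using c x by simp
  qed
  have Tmono: "T (monomial b h \<otimes>\<^bsub>A\<^esub> x) = monomial b h \<otimes>\<^bsub>A\<^esub> T x"
    if b: "b \<in> carrier R" "h \<in> carrier G" and x: "x \<in> carrier A" for b h x
  proof -
    let ?m = "monomial b h"
    have m: "?m \<in> carrier A" using b by simp
    have step: "S (?m \<otimes>\<^bsub>A\<^esub> x) (h \<otimes>\<^bsub>G\<^esub> g) = ?m \<otimes>\<^bsub>A\<^esub> S x g" if g: "g \<in> carrier G" for g
    proof -
      let ?k = "h \<otimes>\<^bsub>G\<^esub> g"
      have k: "?k \<in> carrier G" using b g by simp
      \<comment> \<open>Chosen so that m u_g = u_hg \<kappa>; moving \<kappa> past u_hg applies hg,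
        hence the inverse action here. As \<open>b\<close> may be zero, \<open>?m\<close> is never
        inverted: inserting u_g v_g gives v_hg m = \<kappa> v_g instead.\<close>
      define \<kappa> where "\<kappa> = \<eta> (inv\<^bsub>G\<^esub> ?k) (b \<otimes> f h g)"
      have \<kappa>: "\<kappa> \<in> carrier R" using k b g by (simp add: \<kappa>_def)
      have "\<eta> ?k \<kappa> = b \<otimes> f h g"
        using k b g unfolding \<kappa>_def by (subst action_mult[symmetric]) (simp_all)
      then have mu: "?m \<otimes>\<^bsub>A\<^esub> u g = u ?k \<otimes>\<^bsub>A\<^esub> embed \<kappa>"
        using b g k \<kappa> by (simp add: u_def monomial_mult monomial_embed)
      have "v ?k \<otimes>\<^bsub>A\<^esub> (?m \<otimes>\<^bsub>A\<^esub> x) = v ?k \<otimes>\<^bsub>A\<^esub> ((?m \<otimes>\<^bsub>A\<^esub> (u g \<otimes>\<^bsub>A\<^esub> v g)) \<otimes>\<^bsub>A\<^esub> x)"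
        using g m by simp
      also have "\<dots> = v ?k \<otimes>\<^bsub>A\<^esub> ((?m \<otimes>\<^bsub>A\<^esub> u g) \<otimes>\<^bsub>A\<^esub> (v g \<otimes>\<^bsub>A\<^esub> x))"
        using g k m x by (simp only: A.m_assoc A.m_closed uvc)
      also have "\<dots> = (v ?k \<otimes>\<^bsub>A\<^esub> u ?k) \<otimes>\<^bsub>A\<^esub> (embed \<kappa> \<otimes>\<^bsub>A\<^esub> (v g \<otimes>\<^bsub>A\<^esub> x))"
        unfolding mu using g k \<kappa> x by (simp only: A.m_assoc A.m_closed embed_closed uvc)
      also have "\<dots> = embed \<kappa> \<otimes>\<^bsub>A\<^esub> (v g \<otimes>\<^bsub>A\<^esub> x)"
        using g k \<kappa> x by simp
      finally have "\<pi> (v ?k \<otimes>\<^bsub>A\<^esub> (?m \<otimes>\<^bsub>A\<^esub> x)) = embed \<kappa> \<otimes>\<^bsub>A\<^esub> \<pi> (v g \<otimes>\<^bsub>A\<^esub> x)"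
        using \<pi>lin \<kappa> g x by simp
      then have "S (?m \<otimes>\<^bsub>A\<^esub> x) ?k
          = u ?k \<otimes>\<^bsub>A\<^esub> (embed c \<otimes>\<^bsub>A\<^esub> embed \<kappa>) \<otimes>\<^bsub>A\<^esub> \<pi> (v g \<otimes>\<^bsub>A\<^esub> x)"
        unfolding S_def using g k \<kappa> c x by (simp add: A.m_assoc)
      \<comment> \<open>Commutativity of \<open>R\<close> brings \<kappa> next to
        \<open>u ?k\<close>, where it recombines to \<open>?m\<close> times
        \<open>u g\<close>.\<close>
      also have "embed c \<otimes>\<^bsub>A\<^esub> embed \<kappa> = embed \<kappa> \<otimes>\<^bsub>A\<^esub> embed c"
        using c \<kappa> by (simp flip: embed.hom_mult add: m_comm)
      also have "u ?k \<otimes>\<^bsub>A\<^esub> (embed \<kappa> \<otimes>\<^bsub>A\<^esub> embed c) = (?m \<otimes>\<^bsub>A\<^esub> u g) \<otimes>\<^bsub>A\<^esub> embed c"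
        unfolding mu using k \<kappa> c by (simp add: A.m_assoc)
      also have "\<dots> \<otimes>\<^bsub>A\<^esub> \<pi> (v g \<otimes>\<^bsub>A\<^esub> x) = ?m \<otimes>\<^bsub>A\<^esub> S x g"
        unfolding S_def using m g c x by (simp add: A.m_assoc)
      finally show ?thesis .
    qed
    have "T (?m \<otimes>\<^bsub>A\<^esub> x) = (\<Oplus>\<^bsub>A\<^esub>g \<in> carrier G. S (?m \<otimes>\<^bsub>A\<^esub> x) (h \<otimes>\<^bsub>G\<^esub> g))"
      unfolding T_def using b x m
      by (intro sum_translate[symmetric] A.abelian_group_axioms) auto
    also have "\<dots> = (\<Oplus>\<^bsub>A\<^esub>g \<in> carrier G. ?m \<otimes>\<^bsub>A\<^esub> S x g)"
      using m x by (intro A.finsum_cong') (auto simp: step)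
    also have "\<dots> = ?m \<otimes>\<^bsub>A\<^esub> T x"
      unfolding T_def using m x finite_G by (intro A.finsum_rdistr[symmetric]) auto
    finally show ?thesis .
  qed
  have Tlin: "T (a \<otimes>\<^bsub>A\<^esub> x) = a \<otimes>\<^bsub>A\<^esub> T x" if "a \<in> carrier A" "x \<in> carrier A" for a x
    using that(1)
    by (induction a rule: crossed_product_induct) (use that(2) in \<open>simp_all add: Tmono A.l_distr Tadd\<close>)
  have T0: "T \<zero>\<^bsub>A\<^esub> = \<zero>\<^bsub>A\<^esub>" using Tid Id(2) by simp
  \<comment> \<open>\<open>T\<close> is linear with values in \<open>I\<close> and is the identity
    on \<open>I\<close>, so its kernel is a complement of \<open>I\<close>.\<close>
  define J where "J = {x \<in> carrier A. T x = \<zero>\<^bsub>A\<^esub>}"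
  have J: "left_ideal J A"
    by (rule A.left_ideal_intro) (auto simp: J_def T0 Tadd Tlin)
  moreover have "I \<inter> J = {\<zero>\<^bsub>A\<^esub>}"
    using Tid Id(2) T0 by (auto simp: J_def)
  moreover have "x \<in> I <+>\<^bsub>A\<^esub> J" if x: "x \<in> carrier A" for x
  proof -
    have eq: "x = T x \<oplus>\<^bsub>A\<^esub> (x \<ominus>\<^bsub>A\<^esub> T x)"
      using x Tc[OF x] by algebra
    then have "T x = T (T x) \<oplus>\<^bsub>A\<^esub> T (x \<ominus>\<^bsub>A\<^esub> T x)"
      using x Tadd[of "T x" "x \<ominus>\<^bsub>A\<^esub> T x"] by simp
    then have "T x \<oplus>\<^bsub>A\<^esub> \<zero>\<^bsub>A\<^esub> = T x \<oplus>\<^bsub>A\<^esub> T (x \<ominus>\<^bsub>A\<^esub> T x)"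
      using x Tid[OF TI[OF x]] by simp
    then have "T (x \<ominus>\<^bsub>A\<^esub> T x) = \<zero>\<^bsub>A\<^esub>"
      using x by (metis A.add.l_cancel A.minus_closed A.zero_closed Tc)
    then have "x \<ominus>\<^bsub>A\<^esub> T x \<in> J" using x by (simp add: J_def)
    then show ?thesis
      using eq TI[OF x] unfolding set_add_def' by blast
  qed
  moreover have "I <+>\<^bsub>A\<^esub> J \<subseteq> carrier A"
    by (intro A.left_idealD(1) A.left_ideal_add I J)
  ultimately show ?thesis by blast
qed

theorem semisimple_if_trace_nonzero:
  assumes "field R" "finite (carrier R)" "c \<in> carrier R" "trace c \<noteq> \<zero>"
  shows "semisimple_ring A"
  using trace_one_exists[OF assms(1,3,4)] left_ideal_complement[OF assms(1,2)]
  by (intro A.complemented_imp_semisimple finite_carrier_A assms(2)) blast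

end

section \<open>A central element of square zero\<close>

context crossed_product_datum
begin

lemma finsum_A_apply:
  assumes "F \<in> B \<rightarrow> carrier A" "x \<in> carrier G"
  shows "finsum A F B x = (\<Oplus>i \<in> B. F i x)"
  using assms(1)
proof (induction B rule: infinite_finite_induct)
  case (insert i B)
  have "(\<lambda>i. F i x) \<in> B \<rightarrow> carrier R" "F i x \<in> carrier R"
    using insert.prems assms(2) by (auto simp: Pi_def carrier_A)
  moreover have "F \<in> B \<rightarrow> carrier A" "F i \<in> carrier A"
    using insert.prems by auto
  ultimately show ?case
    using insert.hyps insert.IH assms(2) by (simp add: add_A)
qed (use assms(2) in \<open>simp_all add: zero_A\<close>)

text \<open>The coefficient is a product of conjugates of \<open>b\<close> and cocycle values; its
  exact form is immaterial, only its invertibility and the position of the support are used.\<close>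

lemma monomial_pow:
  assumes "b \<in> Units R" "g \<in> carrier G"
  obtains c where "c \<in> Units R" "monomial b g [^]\<^bsub>A\<^esub> (i::nat) = monomial c (g [^]\<^bsub>G\<^esub> i)"
proof -
  have "\<exists>c \<in> Units R. monomial b g [^]\<^bsub>A\<^esub> i = monomial c (g [^]\<^bsub>G\<^esub> i)"
  proof (induction i)
    case 0
    then show ?case by (auto simp: one_A)
  next
    case (Suc i)
    then obtain c where "c \<in> Units R" "monomial b g [^]\<^bsub>A\<^esub> i = monomial c (g [^]\<^bsub>G\<^esub> i)" by blast
    then show ?case
      using assms by (auto simp: monomial_mult Units_closed
          intro!: bexI[of _ "c \<otimes> \<eta> (g [^]\<^bsub>G\<^esub> i) b \<otimes> f (g [^]\<^bsub>G\<^esub> i) g"])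
  qed
  then show thesis using that by blast
qed

text \<open>Suitably rescaled, the basis element \<open>u\<^sub>\<rho>\<close> becomes a central element \<open>v\<close> with \<open>v\<^sup>q = 1\<close>,
  and \<open>N = 1 + v + \<dots> + v\<^bsup>q-1\<^esup>\<close> satisfies \<open>v N = N\<close>, whence \<open>N\<^sup>2 = q N = 0\<close>.\<close>

theorem not_semisimple_if_central_kernel_element:
  fixes q :: nat
  assumes R: "field R"
    and \<rho>: "\<rho> \<in> carrier G" "\<And>g. g \<in> carrier G \<Longrightarrow> g \<otimes>\<^bsub>G\<^esub> \<rho> = \<rho> \<otimes>\<^bsub>G\<^esub> g"
      "\<And>x. x \<in> carrier R \<Longrightarrow> \<eta> \<rho> x = x"
    and q: "q > 0" "[q] \<cdot> \<one> = \<zero>" "\<rho> [^]\<^bsub>G\<^esub> q = \<one>\<^bsub>G\<^esub>"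
      "\<And>i. \<lbrakk>0 < i; i < q\<rbrakk> \<Longrightarrow> \<rho> [^]\<^bsub>G\<^esub> i \<noteq> \<one>\<^bsub>G\<^esub>"
    and bij: "bij_betw (\<lambda>x. x [^] q) (carrier R) (carrier R)"
  shows "\<not> semisimple_ring A"
proof
  assume ss: "semisimple_ring A"
  let ?e = "f \<one>\<^bsub>G\<^esub> \<one>\<^bsub>G\<^esub>" and ?u = "monomial \<one> \<rho>"
  have Units: "Units R = carrier R - {\<zero>}" using field.field_Units[OF R] .
  obtain a where a: "a \<in> Units R" "?u [^]\<^bsub>A\<^esub> q = monomial a \<one>\<^bsub>G\<^esub>"
    using monomial_pow[OF Units_one_closed \<rho>(1), of q] q(3) by auto
  have "inv (a \<otimes> ?e) \<in> carrier R" using a by simp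
  \<comment> \<open>\<open>monomial a 1\<close> is the embedded scalar
    \<open>a \<otimes> ?e\<close>, so \<beta> must be a q-th root of its inverse.\<close>
  then obtain \<beta> where \<beta>: "\<beta> \<in> carrier R" "\<beta> [^] q = inv (a \<otimes> ?e)"
    using bij_betw_imp_surj_on[OF bij] by (metis (no_types, lifting) imageE)
  have "inv (a \<otimes> ?e) \<in> Units R" using a by simp
  then have "inv (a \<otimes> ?e) \<noteq> \<zero>" unfolding Units by blast
  then have "\<beta> \<noteq> \<zero>" using \<beta>(2) q(1) by (auto simp: nat_pow_zero)
  then have \<beta>U: "\<beta> \<in> Units R" using \<beta>(1) Units by simp
  define v where "v = monomial \<beta> \<rho>"
  have v: "v \<in> carrier A" using \<beta> by (simp add: v_def)
  have vu: "v = embed \<beta> \<otimes>\<^bsub>A\<^esub> ?u" using \<beta> \<rho> by (simp add: v_def embed_monomial)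
  \<comment> \<open>The power of the product splits because \<rho> acts trivially, which makes
    \<open>?u\<close> commute with embedded scalars.\<close>
  have "v [^]\<^bsub>A\<^esub> q = embed \<beta> [^]\<^bsub>A\<^esub> q \<otimes>\<^bsub>A\<^esub> ?u [^]\<^bsub>A\<^esub> q"
    unfolding vu using \<beta> \<rho> by (intro A.pow_mult_distrib) (simp_all add: embed_monomial monomial_embed)
  also have "embed \<beta> [^]\<^bsub>A\<^esub> q = embed (inv (a \<otimes> ?e))"
    using \<beta> by (simp flip: embed.hom_nat_pow)
  also have "?u [^]\<^bsub>A\<^esub> q = embed (a \<otimes> ?e)"
    using a by (simp add: embed_def m_assoc Units_closed)
  also have "embed (inv (a \<otimes> ?e)) \<otimes>\<^bsub>A\<^esub> embed (a \<otimes> ?e) = \<one>\<^bsub>A\<^esub>"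
  proof -
    have "a \<otimes> ?e \<in> Units R" using a by simp
    then have "embed (inv (a \<otimes> ?e) \<otimes> (a \<otimes> ?e)) = \<one>\<^bsub>A\<^esub>"
      by (simp only: Units_l_inv embed_one)
    then show ?thesis
      using \<open>a \<otimes> ?e \<in> Units R\<close> by (simp only: embed.hom_mult Units_closed Units_inv_closed)
  qed
  finally have vq: "v [^]\<^bsub>A\<^esub> q = \<one>\<^bsub>A\<^esub>" .
  have vcomm: "monomial \<gamma> g \<otimes>\<^bsub>A\<^esub> v = v \<otimes>\<^bsub>A\<^esub> monomial \<gamma> g"
    if \<gamma>: "\<gamma> \<in> carrier R" and g: "g \<in> carrier G" for \<gamma> g
  proof -
    have \<beta>f: "\<beta> \<otimes> f \<rho> g \<in> Units R" using \<beta>U \<rho> g by simp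
    \<comment> \<open>The commutator scalar: u_g v and v u_g are supported at the same group element
      because \<rho> commutes with g, and \<open>l\<close> is the ratio of their
      coefficients.\<close>
    define l where "l = \<eta> g \<beta> \<otimes> f g \<rho> \<otimes> inv (\<beta> \<otimes> f \<rho> g)"
    have l: "l \<in> carrier R" using \<beta> g \<rho> \<beta>f by (simp add: l_def)
    have l': "l \<otimes> (\<beta> \<otimes> f \<rho> g) = \<eta> g \<beta> \<otimes> f g \<rho>"
      unfolding l_def using \<beta> g \<rho> \<beta>f by (simp add: m_assoc[of _ "inv (\<beta> \<otimes> f \<rho> g)"] Units_closed)
    have comm: "monomial \<delta> g \<otimes>\<^bsub>A\<^esub> v = embed l \<otimes>\<^bsub>A\<^esub> (v \<otimes>\<^bsub>A\<^esub> monomial \<delta> g)"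
      if \<delta>: "\<delta> \<in> carrier R" for \<delta>
    proof -
      have "\<delta> \<otimes> \<eta> g \<beta> \<otimes> f g \<rho> = \<delta> \<otimes> (l \<otimes> (\<beta> \<otimes> f \<rho> g))"
        unfolding l' using \<beta> g \<rho> \<delta> by (simp add: m_assoc)
      also have "\<dots> = l \<otimes> (\<beta> \<otimes> \<eta> \<rho> \<delta> \<otimes> f \<rho> g)"
        using \<beta> g \<rho> \<delta> l by (simp add: m_ac)
      finally show ?thesis
        unfolding v_def using \<beta> g \<rho> \<delta> l by (simp add: monomial_mult embed_monomial)
    qed
    let ?m = "monomial \<one> g"
    have m: "?m \<in> carrier A" by simp
    have lv: "v \<otimes>\<^bsub>A\<^esub> embed x = embed x \<otimes>\<^bsub>A\<^esub> v" if "x \<in> carrier R" for x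
      using that \<beta> \<rho> by (simp add: v_def embed_monomial monomial_embed m_comm)
    \<comment> \<open>Scalars commute with \<open>v\<close>, so each passage of \<open>?m\<close>
      across a factor \<open>v\<close> contributes one more \<open>l\<close>. At i = q the power of
      \<open>v\<close> disappears and leaves l^q = 1.\<close>
    have "?m \<otimes>\<^bsub>A\<^esub> v [^]\<^bsub>A\<^esub> i = embed (l [^] i) \<otimes>\<^bsub>A\<^esub> (v [^]\<^bsub>A\<^esub> i \<otimes>\<^bsub>A\<^esub> ?m)" for i :: nat
    proof (induction i)
      case 0
      then show ?case by (simp add: embed_one)
    next
      case (Suc i)
      let ?L = "embed (l [^] i)" and ?V = "v [^]\<^bsub>A\<^esub> i"
      have c: "?L \<in> carrier A" "?V \<in> carrier A" "embed l \<in> carrier A" using l v by auto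
      have Vl: "?V \<otimes>\<^bsub>A\<^esub> embed l = embed l \<otimes>\<^bsub>A\<^esub> ?V"
        using A.group_commutes_pow[OF lv[OF l] v c(3)] .
      have "?m \<otimes>\<^bsub>A\<^esub> v [^]\<^bsub>A\<^esub> Suc i = (?m \<otimes>\<^bsub>A\<^esub> ?V) \<otimes>\<^bsub>A\<^esub> v"
        using m c v by (simp add: A.m_assoc)
      also have "\<dots> = ?L \<otimes>\<^bsub>A\<^esub> (?V \<otimes>\<^bsub>A\<^esub> (?m \<otimes>\<^bsub>A\<^esub> v))"
        unfolding Suc.IH using m c v by (simp add: A.m_assoc)
      also have "\<dots> = ?L \<otimes>\<^bsub>A\<^esub> ((?V \<otimes>\<^bsub>A\<^esub> embed l) \<otimes>\<^bsub>A\<^esub> (v \<otimes>\<^bsub>A\<^esub> ?m))"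
        unfolding comm[OF one_closed] using m c v by (simp add: A.m_assoc)
      also have "\<dots> = (?L \<otimes>\<^bsub>A\<^esub> embed l) \<otimes>\<^bsub>A\<^esub> ((?V \<otimes>\<^bsub>A\<^esub> v) \<otimes>\<^bsub>A\<^esub> ?m)"
        unfolding Vl using m c v by (simp add: A.m_assoc)
      finally show ?case using l by simp
    qed
    from this[of q] have "monomial \<one> g = monomial (l [^] q) g"
      using l g m unfolding vq by (simp add: embed_monomial)
    then have "monomial \<one> g g = monomial (l [^] q) g g" by simp
    then have "l [^] q = \<one>" using g by (simp add: monomial_def)
    then have "l [^] q = \<one> [^] q" by simp
    then have "l = \<one>"
      using inj_onD[OF bij_betw_imp_inj_on[OF bij] _ l one_closed] by simp
    then show ?thesis
      using comm[OF \<gamma>] \<gamma> v by (simp add: embed_one)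
  qed
  have central: "a \<otimes>\<^bsub>A\<^esub> v = v \<otimes>\<^bsub>A\<^esub> a" if "a \<in> carrier A" for a
    using that by (induction a rule: crossed_product_induct)
      (use v in \<open>simp_all add: vcomm A.l_distr A.r_distr\<close>)
  define N where "N = (\<Oplus>\<^bsub>A\<^esub>i \<in> {..<q}. v [^]\<^bsub>A\<^esub> i)"
  have N: "N \<in> carrier A" using v by (simp add: N_def)
  have Ncentral: "N \<otimes>\<^bsub>A\<^esub> a = a \<otimes>\<^bsub>A\<^esub> N" if a: "a \<in> carrier A" for a
  proof -
    have "v [^]\<^bsub>A\<^esub> i \<otimes>\<^bsub>A\<^esub> a = a \<otimes>\<^bsub>A\<^esub> v [^]\<^bsub>A\<^esub> i" for i :: nat
      using A.group_commutes_pow[OF central[OF a, symmetric] v a] .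
    then show ?thesis
      unfolding N_def using a v by (simp add: A.finsum_ldistr A.finsum_rdistr)
  qed
  have vN: "v \<otimes>\<^bsub>A\<^esub> N = N"
  proof -
    obtain p where p: "q = Suc p" using q(1) gr0_conv_Suc by blast
    have N': "N = (\<Oplus>\<^bsub>A\<^esub>i \<in> {..p}. v [^]\<^bsub>A\<^esub> i)" unfolding N_def p lessThan_Suc_atMost ..
    have "v \<otimes>\<^bsub>A\<^esub> N = (\<Oplus>\<^bsub>A\<^esub>i \<in> {..p}. v \<otimes>\<^bsub>A\<^esub> v [^]\<^bsub>A\<^esub> i)"
      unfolding N' using v by (intro A.finsum_rdistr) auto
    also have "\<dots> = (\<Oplus>\<^bsub>A\<^esub>i \<in> {..p}. v [^]\<^bsub>A\<^esub> Suc i)"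
      using v A.nat_pow_Suc2[OF v] by (intro A.finsum_cong') auto
    \<comment> \<open>Both sides are the sum of v^i for i from 0 to q, split off at the bottom and
      at the top; the two end terms agree since v^q = v^0.\<close>
    finally have "v \<otimes>\<^bsub>A\<^esub> N \<oplus>\<^bsub>A\<^esub> v [^]\<^bsub>A\<^esub> (0::nat) = v [^]\<^bsub>A\<^esub> Suc p \<oplus>\<^bsub>A\<^esub> N"
      using A.finsum_Suc2[of "\<lambda>i. v [^]\<^bsub>A\<^esub> i" p] A.finsum_Suc[of "\<lambda>i. v [^]\<^bsub>A\<^esub> i" p] v
      unfolding N' by (simp del: A.nat_pow_Suc)
    then have "v \<otimes>\<^bsub>A\<^esub> N \<oplus>\<^bsub>A\<^esub> \<one>\<^bsub>A\<^esub> = N \<oplus>\<^bsub>A\<^esub> \<one>\<^bsub>A\<^esub>"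
      using vq N unfolding p by (simp add: A.a_comm del: A.nat_pow_Suc)
    then show ?thesis using v N by (simp add: A.add.r_cancel)
  qed
  have vpN: "v [^]\<^bsub>A\<^esub> i \<otimes>\<^bsub>A\<^esub> N = N" for i :: nat
    using v N by (induction i) (simp_all add: A.m_assoc vN)
  have "N \<otimes>\<^bsub>A\<^esub> N = (\<Oplus>\<^bsub>A\<^esub>i \<in> {..<q}. v [^]\<^bsub>A\<^esub> i \<otimes>\<^bsub>A\<^esub> N)"
    using A.finsum_ldistr[of "{..<q}" N "\<lambda>i. v [^]\<^bsub>A\<^esub> i"] v N unfolding N_def by auto
  \<comment> \<open>Writing the unit as \<open>embed \<one>\<close> moves the sum of
    \<open>q\<close> ones into \<open>R\<close>, where it is known to vanish.\<close>
  also have "\<dots> = (\<Oplus>\<^bsub>A\<^esub>i \<in> {..<q}. embed \<one> \<otimes>\<^bsub>A\<^esub> N)"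
    using N by (simp add: vpN)
  also have "\<dots> = (\<Oplus>\<^bsub>A\<^esub>i \<in> {..<q}. embed \<one>) \<otimes>\<^bsub>A\<^esub> N"
    using N by (intro A.finsum_ldistr[symmetric]) auto
  also have "(\<Oplus>\<^bsub>A\<^esub>i \<in> {..<q}. embed \<one>) = embed (\<Oplus>i \<in> {..<q}. \<one>)"
    by (rule embed_finsum[symmetric]) auto
  also have "\<dots> \<otimes>\<^bsub>A\<^esub> N = \<zero>\<^bsub>A\<^esub>"
    using q(2) N by (simp add: add.finprod_const)
  finally have "N \<otimes>\<^bsub>A\<^esub> N = \<zero>\<^bsub>A\<^esub>" .
  then have N0: "N = \<zero>\<^bsub>A\<^esub>"
    using A.semisimple_central_square_zero[OF ss N] Ncentral by blast
  \<comment> \<open>Coefficient of \<open>N\<close> at the identity: for 0 < i < q the power v^i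
    lives at \<rho>^i, away from the identity, so only i = 0 contributes.\<close>
  have "(v [^]\<^bsub>A\<^esub> i) \<one>\<^bsub>G\<^esub> = (if i = 0 then inv ?e else \<zero>)" if "i < q" for i
  proof (cases "i = 0")
    case True
    then show ?thesis by (simp add: one_A monomial_def)
  next
    case False
    obtain c where "v [^]\<^bsub>A\<^esub> i = monomial c (\<rho> [^]\<^bsub>G\<^esub> i)"
      using monomial_pow[OF \<beta>U \<rho>(1)] unfolding v_def by blast
    then show ?thesis using False q(4)[of i] that by (auto simp: monomial_def)
  qed
  then have "N \<one>\<^bsub>G\<^esub> = (\<Oplus>i \<in> {..<q}. if i = 0 then inv ?e else \<zero>)"
    unfolding N_def using v by (subst finsum_A_apply) (auto intro!: finsum_cong')
  also have "\<dots> = inv ?e"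
    using add.finprod_singleton_swap[of 0 "{..<q}" "\<lambda>_. inv ?e"] q(1) by auto
  finally have "inv ?e = \<zero>" using N0 by (simp add: zero_A)
  moreover have "inv ?e \<in> Units R" by simp
  ultimately show False using Units by auto
qed

end

section \<open>Frobenius action on a finite field\<close>

text \<open>\<open>D\<close> is a set, so the powers of X have distinct exponents and nothing
  cancels. The polynomial is nonzero of degree \<open>Max D\<close>, below the size of the field,
  and its roots cannot fill the field.\<close>

lemma (in field) sum_of_powers_nonvanishing:
  assumes "finite (carrier R)" "finite D" "D \<noteq> {}" "\<And>d. d \<in> D \<Longrightarrow> d < card (carrier R)"
  obtains x where "x \<in> carrier R" "(\<Oplus>d \<in> D. x [^] (d::nat)) \<noteq> \<zero>"
proof -
  interpret P: UP_domain R "UP R" by unfold_locales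
  interpret E: UP_pre_univ_prop R R id "UP R" by unfold_locales simp
  define p where "p = (\<Oplus>\<^bsub>UP R\<^esub>d \<in> D. up_ring.monom (UP R) \<one> d)"
  have p: "p \<in> carrier (UP R)" unfolding p_def by (rule P.P.finsum_closed) auto
  have "up_ring.coeff (UP R) p j = (\<Oplus>d \<in> D. if d = j then \<one> else \<zero>)" for j
    unfolding p_def using assms(2) by (subst P.coeff_finsum) auto
  then have coeff: "up_ring.coeff (UP R) p j = (if j \<in> D then \<one> else \<zero>)" for j
    using add.finprod_singleton_swap[OF _ assms(2), of j "\<lambda>_. \<one>"] by (auto intro: add.finprod_one_eqI)
  have eval: "UnivPoly.eval R R id x p = (\<Oplus>d \<in> D. x [^] d)" if x: "x \<in> carrier R" for x
  proof -
    interpret h: ring_hom_ring "UP R" R "UnivPoly.eval R R id x"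
      by (intro ring_hom_ringI2 P.P.ring_axioms ring_axioms E.eval_ring_hom x)
    have "UnivPoly.eval R R id x p = (\<Oplus>d \<in> D. UnivPoly.eval R R id x (up_ring.monom (UP R) \<one> d))"
      unfolding p_def by (simp add: comp_def)
    also have "\<dots> = (\<Oplus>d \<in> D. x [^] d)"
      using x by (intro finsum_cong') (auto simp: E.eval_monom)
    finally show ?thesis .
  qed
  have "UnivPoly.deg R p \<le> Max D"
  proof (rule P.deg_aboveI[OF _ p])
    show "up_ring.coeff (UP R) p m = \<zero>" if "Max D < m" for m
      using that Max_ge[OF assms(2), of m] by (auto simp: coeff)
  qed
  also have "Max D < card (carrier R)"
    using assms(4) Max_in[OF assms(2,3)] by blast
  finally have deg: "UnivPoly.deg R p < card (carrier R)" .
  have "up_ring.coeff (UP R) p (Max D) \<noteq> up_ring.coeff (UP R) \<zero>\<^bsub>UP R\<^esub> (Max D)"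
    using Max_in[OF assms(2,3)] by (simp add: coeff)
  then have "p \<noteq> \<zero>\<^bsub>UP R\<^esub>" by blast
  then have "card {x \<in> carrier R. UnivPoly.eval R R id x p = \<zero>} < card (carrier R)"
    using P.roots_bound[OF p _ assms(1)] deg by auto
  then have "{x \<in> carrier R. UnivPoly.eval R R id x p = \<zero>} \<noteq> carrier R" by auto
  then obtain x where "x \<in> carrier R" "UnivPoly.eval R R id x p \<noteq> \<zero>" by blast
  then show thesis using that[of x] eval[of x] by simp
qed

lemma (in field) finite_field_pow_card:
  assumes "finite (carrier R)" "x \<in> carrier R"
  shows "x [^] card (carrier R) = x"
proof -
  have c: "card (carrier R) > 0" using assms by (auto simp: card_gt_0_iff)
  show ?thesis
  proof (cases "x = \<zero>")
    case True
    then show ?thesis using c by (auto simp: nat_pow_zero)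
  next
    case False
    then have "x [^] (card (carrier R) - 1) = \<one>"
      using group.pow_order_eq_1[OF field_mult_group, of x] assms order_mult_of
      by (simp add: Multiplicative_Group.nat_pow_mult_of order_def)
    then show ?thesis
      using assms(2) c nat_pow_Suc[of x "card (carrier R) - 1"] by simp
  qed
qed

context
  fixes R (structure) and q r :: nat
  assumes field: "field R" and q: "Factorial_Ring.prime q" and r: "r > 0"
    and card: "card (carrier R) = q ^ r"
begin

interpretation field R by (rule field)

lemma finite_carrier_prime_power: "finite (carrier R)"
  using card q by (metis card.infinite not_prime_0 power_not_zero)

lemma pow_card_power:
  assumes "x \<in> carrier R"
  shows "x [^] (q ^ (r * j)) = x"
proof (induction j)
  case (Suc j)
  have "x [^] (q ^ (r * Suc j)) = (x [^] (q ^ r)) [^] (q ^ (r * j))"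
    using assms by (simp add: nat_pow_pow power_add)
  then show ?case
    using Suc finite_field_pow_card[OF finite_carrier_prime_power assms] card by simp
qed (use assms in simp)

text \<open>The inverse is the power map with exponent q^(r-1), because x^(q^r) = x; positivity of
  \<open>r\<close> enters here.\<close>

lemma prime_power_map_bij: "bij_betw (\<lambda>x. x [^] q) (carrier R) (carrier R)"
proof (rule bij_betw_byWitness[where f' = "\<lambda>x. x [^] (q ^ (r - 1))"])
  have "q * q ^ (r - 1) = q ^ r" using r by (simp add: power_eq_if)
  then show "\<forall>x \<in> carrier R. (x [^] q) [^] (q ^ (r - 1)) = x"
    "\<forall>x \<in> carrier R. (x [^] (q ^ (r - 1))) [^] q = x"
    using pow_card_power[of _ 1] by (simp_all add: nat_pow_pow mult.commute)
qed auto

lemma prime_power_iterate_bij: "bij_betw (\<lambda>x. x [^] (q ^ k)) (carrier R) (carrier R)"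
proof (induction k)
  case (Suc k)
  have "bij_betw ((\<lambda>x. x [^] q) \<circ> (\<lambda>x. x [^] (q ^ k))) (carrier R) (carrier R)"
    using Suc prime_power_map_bij by (rule bij_betw_trans)
  moreover have "bij_betw ((\<lambda>x. x [^] q) \<circ> (\<lambda>x. x [^] (q ^ k))) (carrier R) (carrier R)
      \<longleftrightarrow> bij_betw (\<lambda>x. x [^] (q ^ Suc k)) (carrier R) (carrier R)"
    by (rule bij_betw_cong) (simp add: nat_pow_pow mult.commute)
  ultimately show ?case by simp
qed (simp add: bij_betw_def inj_on_def)

text \<open>Lagrange in the additive group kills q^r times \<open>\<one>\<close>, which is the r-th
  power of q times \<open>\<one>\<close>. A field has no nonzero nilpotents, so the additive order
  of \<open>\<one>\<close> divides \<open>q\<close>; it is not 1, and \<open>q\<close> is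
  prime.\<close>

lemma characteristic: "[m] \<cdot> \<one> = \<zero> \<longleftrightarrow> q dvd m" for m :: nat
proof -
  let ?o = "group.ord (add_monoid R) \<one>"
  have eq: "[m] \<cdot> \<one> = \<zero> \<longleftrightarrow> ?o dvd m" for m :: nat
    using add.pow_eq_id[of \<one> m] by simp
  have pow: "[(q ^ i)] \<cdot> \<one> = ([q] \<cdot> \<one>) [^] i" for i :: nat
  proof (induction i)
    case (Suc i)
    have "[(q ^ Suc i)] \<cdot> \<one> = [q] \<cdot> ([(q ^ i)] \<cdot> \<one>)"
      by (simp add: add.nat_pow_pow mult.commute)
    also have "\<dots> = ([q] \<cdot> \<one>) [^] i \<otimes> [q] \<cdot> \<one>"
      by (simp add: Suc.IH add_pow_rdistr)
    finally show ?case by simp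
  qed simp
  have "[(q ^ r)] \<cdot> \<one> = \<zero>"
    using add.pow_order_eq_1[of \<one>] card by (simp add: order_def)
  then have "([q] \<cdot> \<one>) [^] r = \<zero>" by (simp add: pow)
  moreover have "y [^] i = \<zero> \<Longrightarrow> y = \<zero>" if "y \<in> carrier R" for y and i :: nat
    using that by (induction i) (auto simp: integral_iff)
  ultimately have "[q] \<cdot> \<one> = \<zero>" by simp
  then have "?o dvd q" by (simp add: eq)
  moreover have "?o \<noteq> 1" using eq[of 1] by auto
  ultimately have "?o = q" using q by (auto simp: prime_nat_iff)
  then show ?thesis using eq by simp
qed

lemma frobenius_pow:
  "frobenius R q [^]\<^bsub>RingAutoGroup R\<^esub> k = (\<lambda>x \<in> carrier R. x [^] (q ^ k))"
proof (induction k)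
  case 0
  show ?case by (auto simp: RingAutoGroup_def BijGroup_def)
next
  case (Suc k)
  have *: "(\<lambda>x \<in> carrier R. x [^] (q ^ k)) \<in> Bij (carrier R)" for k
    using prime_power_iterate_bij by (simp add: Bij_def)
  have "frobenius R q \<in> Bij (carrier R)"
    using *[of 1] by (simp add: frobenius_def)
  then have "frobenius R q [^]\<^bsub>RingAutoGroup R\<^esub> Suc k
      = compose (carrier R) (\<lambda>x \<in> carrier R. x [^] (q ^ k)) (frobenius R q)"
    using RingAutoGroup_mult[OF *[of k]] by (simp only: Group.nat_pow_Suc Suc.IH)
  also have "\<dots> = (\<lambda>x \<in> carrier R. x [^] (q ^ Suc k))"
    by (auto simp: compose_def frobenius_def fun_eq_iff nat_pow_pow)
  finally show ?case .
qed

end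

text \<open>Source of the factor \<open>nk/r\<close> in the trace: the automorphisms attached to the
  powers of the generator repeat with period \<open>r/k\<close>, and \<open>n\<close> is
  \<open>nk/r\<close> periods long.\<close>

lemma (in abelian_monoid) finsum_periodic:
  fixes h :: "nat \<Rightarrow> 'a"
  assumes "\<And>i. h i \<in> carrier G" "\<And>i. h (i + s) = h i"
  shows "finsum G h {..<s * m} = [m] \<cdot> finsum G h {..<s}"
proof (induction m)
  case (Suc m)
  have shift: "h (s * m + i) = h i" for i
  proof (induction m)
    case (Suc m)
    have "s * Suc m + i = (s * m + i) + s" by simp
    then show ?case using Suc assms(2) by metis
  qed simp
  have "{..<s * Suc m} = {..<s * m} \<union> (+) (s * m) ` {..<s}"
    using image_add_atLeastLessThan[of "s * m" 0 s] by (auto simp: lessThan_atLeast0)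
  moreover have "finsum G h ((+) (s * m) ` {..<s}) = finsum G h {..<s}"
    using assms(1) by (subst add.finprod_reindex) (auto simp: shift)
  ultimately show ?case
    using assms(1) Suc by (simp, subst finsum_Un_disjoint) auto
qed simp

lemma (in group) generator_powers_bij:
  assumes "finite (carrier G)" "a \<in> carrier G" "generate G {a} = carrier G"
  shows "bij_betw (\<lambda>i::nat. a [^] i) {..<card (carrier G)} (carrier G)"
proof -
  have ord: "ord a = card (carrier G)" "ord a \<noteq> 0"
    using generate_pow_card[OF assms(2)] assms by auto
  have "{0..ord a - 1} = {..<card (carrier G)}" using ord by auto
  moreover have "carrier G = (\<lambda>i::nat. a [^] i) ` {0..ord a - 1}"
    using generate_pow_nat[OF assms(2) ord(2)] ord_elems_inf_carrier[OF assms(2) ord(2)] assms(3)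
    by auto
  ultimately show ?thesis using ord_inj[OF assms(2)] by (simp add: bij_betw_def)
qed

theorem corollary3p1:
  fixes q n r k :: nat
    and F :: "('a, 'b) ring_scheme"
    and G :: "('g, 'c) monoid_scheme"
    and \<sigma> :: 'g
    and \<eta> :: "'g \<Rightarrow> 'a \<Rightarrow> 'a"
    and f :: "'g \<Rightarrow> 'g \<Rightarrow> 'a"
  assumes "Factorial_Ring.prime q"
    and "n > 0" and "r > 0" and "k > 0"
    and "k dvd r" and "(r div k) dvd n"
    and "field F" and "card (carrier F) = q ^ r"
    and "group G" and "card (carrier G) = n"
    and "\<sigma> \<in> carrier G" and "generate G {\<sigma>} = carrier G"
    and "\<eta> \<in> hom G (RingAutoGroup F)"
    and "\<eta> \<sigma> = frobenius F q [^]\<^bsub>RingAutoGroup F\<^esub> k"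
    and "f \<in> two_cocycles G F \<eta>"
  shows "semisimple_ring (crossed_product F G \<eta> f) \<longleftrightarrow> gcd (n * k div r) q = 1"
proof -
  note q = assms(1) and FF = assms(7,1,3,8)
  interpret F: field F by fact
  interpret G: group G by fact
  have fin: "finite (carrier G)" using assms(2,10) by (auto intro: card_ge_0_finite)
  interpret crossed_product_datum F G \<eta> f
    by unfold_locales (use assms(13,15) fin in auto)
  \<comment> \<open>The order of the automorphism attached to \<sigma>. Below, n = s m, so m equals
    nk/r and the natural-number division in the statement is exact.\<close>
  define s where "s = r div k"
  have r: "r = k * s" using assms(5) by (simp add: s_def)
  then have s: "s > 0" using assms(3) by auto
  obtain m where n: "n = s * m" using assms(6) by (auto simp: s_def)
  have m: "n * k div r = m" using r n assms(3) by (simp add: ac_simps)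
  have q2: "q \<ge> 2" using q by (rule prime_ge_2_nat)
  have act: "\<eta> (\<sigma> [^]\<^bsub>G\<^esub> i) x = x [^]\<^bsub>F\<^esub> (q ^ (k * i))" if "x \<in> carrier F" for i x
    using that
  proof (induction i arbitrary: x)
    case (Suc i)
    have "\<eta> (\<sigma> [^]\<^bsub>G\<^esub> Suc i) x = \<eta> (\<sigma> [^]\<^bsub>G\<^esub> i) (\<eta> \<sigma> x)"
      using assms(11) Suc.prems by (simp add: action_mult)
    also have "\<eta> \<sigma> x = x [^]\<^bsub>F\<^esub> (q ^ k)"
      using assms(14) frobenius_pow[OF FF] Suc.prems by simp
    finally show ?case
      using Suc by (simp add: F.nat_pow_pow power_add)
  qed simp
  have gen: "bij_betw (\<lambda>i::nat. \<sigma> [^]\<^bsub>G\<^esub> i) {..<n} (carrier G)"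
    using G.generator_powers_bij[OF fin assms(11,12)] assms(10) by simp
  have finF: "finite (carrier F)" by (rule finite_carrier_prime_power[OF FF])
  show ?thesis
  proof
    assume "gcd (n * k div r) q = 1"
    then have "\<not> q dvd m" unfolding m using q2 by (auto simp: gcd_nat.absorb2)
    \<comment> \<open>Exponents of the power maps in one period; they stay below q^(ks) = q^r, as
      the root count demands.\<close>
    define D where "D = (\<lambda>i. q ^ (k * i)) ` {..<s}"
    have inj: "inj_on (\<lambda>i. q ^ (k * i)) {..<s}"
      using q2 assms(4) by (auto simp: inj_on_def)
    have "d < card (carrier F)" if "d \<in> D" for d
      using that q2 assms(4) unfolding assms(8) r D_def by (auto intro!: power_strict_increasing)
    then obtain x where x: "x \<in> carrier F" "(\<Oplus>\<^bsub>F\<^esub>d \<in> D. x [^]\<^bsub>F\<^esub> d) \<noteq> \<zero>\<^bsub>F\<^esub>"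
      using F.sum_of_powers_nonvanishing[OF finF, of D] s by (auto simp: D_def)
    let ?h = "\<lambda>i. x [^]\<^bsub>F\<^esub> (q ^ (k * i))"
    have Dsum: "(\<Oplus>\<^bsub>F\<^esub>d \<in> D. x [^]\<^bsub>F\<^esub> d) = finsum F ?h {..<s}"
      unfolding D_def using x inj by (subst F.add.finprod_reindex) auto
    have "trace x = finsum F (\<lambda>g. \<eta> g x) ((\<lambda>i. \<sigma> [^]\<^bsub>G\<^esub> i) ` {..<n})"
      using gen by (simp add: trace_def bij_betw_def)
    also have "\<dots> = finsum F (\<lambda>i. \<eta> (\<sigma> [^]\<^bsub>G\<^esub> i) x) {..<n}"
      using gen x(1) assms(11) by (intro F.add.finprod_reindex) (auto simp: bij_betw_def)
    also have "\<dots> = finsum F ?h {..<s * m}"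
      using x(1) by (simp add: act n)
    also have "\<dots> = [m] \<cdot>\<^bsub>F\<^esub> finsum F ?h {..<s}"
    proof (rule F.finsum_periodic)
      show "?h (i + s) = ?h i" for i
      proof -
        have "?h (i + s) = (?h i) [^]\<^bsub>F\<^esub> (q ^ (r * 1))"
          using x(1) by (simp add: F.nat_pow_pow distrib_left power_add r)
        then show ?thesis using pow_card_power[OF FF, of "?h i" 1] x(1) by simp
      qed
    qed (use x in auto)
    also have "\<dots> = ([m] \<cdot>\<^bsub>F\<^esub> \<one>\<^bsub>F\<^esub>) \<otimes>\<^bsub>F\<^esub> finsum F ?h {..<s}"
      using x(1) by (simp add: F.add_pow_ldistr)
    finally have "trace x \<noteq> \<zero>\<^bsub>F\<^esub>"
      using x characteristic[OF FF, of m] \<open>\<not> q dvd m\<close> unfolding Dsum by (auto simp: F.integral_iff)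
    then show "semisimple_ring A"
      by (rule semisimple_if_trace_nonzero[OF assms(7) finF x(1)])
  next
    assume ss: "semisimple_ring A"
    show "gcd (n * k div r) q = 1"
    proof (rule ccontr)
      assume "gcd (n * k div r) q \<noteq> 1"
      then have "q dvd m"
        unfolding m using q prime_imp_coprime[OF q, of m] by (auto simp: coprime_iff_gcd_eq_1 gcd.commute)
      then obtain j where j: "m = q * j" by blast
      \<comment> \<open>This is n/q, written as a multiple of \<open>s\<close>: then k e = r j, so
        \<sigma>^e acts trivially. Divisibility of \<open>m\<close> by \<open>q\<close>, rather than
        of \<open>n\<close>, is what makes this possible.\<close>
      define e where "e = s * j"
      have nqe: "n = e * q" by (simp add: n j e_def)
      define \<rho> where "\<rho> = \<sigma> [^]\<^bsub>G\<^esub> e"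
      have "\<not> semisimple_ring A"
      proof (rule not_semisimple_if_central_kernel_element[OF assms(7), where q = q and \<rho> = \<rho>])
        show "\<rho> \<in> carrier G" using assms(11) by (simp add: \<rho>_def)
        show "g \<otimes>\<^bsub>G\<^esub> \<rho> = \<rho> \<otimes>\<^bsub>G\<^esub> g" if "g \<in> carrier G" for g
        proof -
          have "g \<in> (\<lambda>i. \<sigma> [^]\<^bsub>G\<^esub> i) ` {..<n}" using that gen by (simp add: bij_betw_def)
          then show ?thesis unfolding \<rho>_def using assms(11) by (auto simp: G.nat_pow_comm)
        qed
        show "\<eta> \<rho> x = x" if "x \<in> carrier F" for x
          using act[OF that, of e] pow_card_power[OF FF that, of j]
          by (simp add: \<rho>_def e_def r mult.assoc)
        show "q > 0" using q2 by simp
        show "[q] \<cdot>\<^bsub>F\<^esub> \<one>\<^bsub>F\<^esub> = \<zero>\<^bsub>F\<^esub>" using characteristic[OF FF] by simp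
        show "\<rho> [^]\<^bsub>G\<^esub> q = \<one>\<^bsub>G\<^esub>"
          using G.pow_order_eq_1[OF assms(11)] assms(10,11)
          by (simp add: \<rho>_def G.nat_pow_pow order_def flip: nqe)
        show "\<rho> [^]\<^bsub>G\<^esub> i \<noteq> \<one>\<^bsub>G\<^esub>" if "0 < i" "i < q" for i
        proof
          assume "\<rho> [^]\<^bsub>G\<^esub> i = \<one>\<^bsub>G\<^esub>"
          then have "\<sigma> [^]\<^bsub>G\<^esub> (e * i) = \<sigma> [^]\<^bsub>G\<^esub> (0::nat)"
            using assms(11) by (simp add: \<rho>_def G.nat_pow_pow)
          moreover have "e > 0" using nqe assms(2) by (cases e) auto
          \<comment> \<open>For i < q the exponent stays below e q = n, where powers of the
            generator are distinct.\<close>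
          moreover have "e * i \<in> {..<n}" "0 \<in> {..<n}"
            using that \<open>e > 0\<close> nqe by auto
          ultimately have "e * i = 0"
            using bij_betw_imp_inj_on[OF gen] by (meson inj_onD)
          then show False using \<open>e > 0\<close> that by simp
        qed
        show "bij_betw (\<lambda>x. x [^]\<^bsub>F\<^esub> q) (carrier F) (carrier F)"
          by (rule prime_power_map_bij[OF FF])
      qed
      then show False using ss by simp
    qed
  qed
qed

end
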